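(* For any positive integer $n$ and any even positive integer $t$, $$\sum_{\lambda}\ \prod_{h \in \mathcal{H}_{t}(\lambda)}\frac{1}{h}= \frac{1}{n!\, 2^n\, t^n},$$ where the sum ranges over all self-conjugate partitions $\lambda$ such that $|\lambda|=2tn$ and $\#\mathcal{H}_{t}(\lambda)=2n$.
   Context: A partition $\lambda=(\lambda_1,\ldots,\lambda_\ell)$ is a finite non-increasing sequence of positive integers; its weight is $|\lambda|=\sum_i\lambda_i$. It is self-conjugate if it equals its conjugate (the reflection of its Ferrers diagram in the principal diagonal). $\mathcal{H}_t(\lambda)$ is the multi-set of hook lengths of the boxes of $\lambda$ which are integral multiples of $t$, and $\#\mathcal{H}_t(\lambda)$ is its cardinality counted with multiplicity. *)

theory Defs
  imports Complex_Main "HOL-Library.Multiset"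
begin

definition is_partition :: "nat list \<Rightarrow> bool" where
  "is_partition xs \<longleftrightarrow> sorted_wrt (\<ge>) xs \<and> (\<forall>x\<in>set xs. 0 < x)"

(* Boxes are pairs (row, column), both counted from 0. *)
definition ferrers :: "nat list \<Rightarrow> (nat \<times> nat) set" where
  "ferrers xs = {(i, j). i < length xs \<and> j < xs ! i}"

(* The parts of the conjugate are the column lengths; the lemma ferrers_conjugate
   below shows that its diagram is the reflection of the diagram of xs. *)
definition conjugate :: "nat list \<Rightarrow> nat list" where
  "conjugate xs =
     map (\<lambda>j. card {i. (i, j) \<in> ferrers xs}) [0..<(if xs = [] then 0 else hd xs)]"

definition self_conjugate :: "nat list \<Rightarrow> bool" where
  "self_conjugate xs \<longleftrightarrow> conjugate xs = xs"

(* The hook of a box consists of the box itself, the boxes to its right in the same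
   row and the boxes below it in the same column. *)
definition hook_length :: "nat list \<Rightarrow> nat \<times> nat \<Rightarrow> nat" where
  "hook_length xs b =
     card {c \<in> ferrers xs. (fst c = fst b \<and> snd b \<le> snd c) \<or> (snd c = snd b \<and> fst b \<le> fst c)}"

definition hooks :: "nat \<Rightarrow> nat list \<Rightarrow> nat multiset" where
  "hooks t xs = filter_mset (\<lambda>h. t dvd h) (image_mset (hook_length xs) (mset_set (ferrers xs)))"

lemma ferrers_Sigma: "ferrers xs = (SIGMA i:{..<length xs}. {..<xs ! i})"
  by (auto simp: ferrers_def)

lemma finite_ferrers [simp]: "finite (ferrers xs)"
  by (simp add: ferrers_Sigma)

lemma card_ferrers: "card (ferrers xs) = sum_list xs"
  by (simp add: ferrers_Sigma sum_list_sum_nth lessThan_atLeast0)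

lemma is_partition_nth_mono:
  assumes "is_partition xs" "i \<le> j" "j < length xs"
  shows "xs ! j \<le> xs ! i"
proof (cases "i = j")
  case False
  then show ?thesis
    using assms by (simp add: is_partition_def sorted_wrt_iff_nth_less)
qed simp

lemma ferrers_down_closed:
  assumes "is_partition xs" "(i, j) \<in> ferrers xs" "i' \<le> i" "j' \<le> j"
  shows "(i', j') \<in> ferrers xs"
  using is_partition_nth_mono[OF assms(1,3)] assms(2-4) by (auto simp: ferrers_def)

lemma ferrers_column:
  assumes "is_partition xs"
  shows "{i. (i, j) \<in> ferrers xs} = {..<card {i. (i, j) \<in> ferrers xs}}"
proof -
  let ?A = "{i. (i, j) \<in> ferrers xs}"
  have fin: "finite ?A"
    by (rule finite_subset[of _ "{..<length xs}"]) (auto simp: ferrers_def)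
  define k where "k = (LEAST k. k \<notin> ?A)"
  have "\<exists>k. k \<notin> ?A"
    using fin infinite_UNIV_nat by (metis UNIV_eq_I)
  then have k: "k \<notin> ?A" "\<And>i. i < k \<Longrightarrow> i \<in> ?A"
    unfolding k_def by (rule LeastI_ex, use not_less_Least in blast)
  have "?A = {..<k}"
    using k ferrers_down_closed[OF assms, of _ j k j] by (auto simp: not_less[symmetric])
  then show ?thesis
    by simp
qed

lemma ferrers_conjugate:
  assumes "is_partition xs"
  shows "ferrers (conjugate xs) = prod.swap ` ferrers xs"
proof -
  have hd: "j < hd xs" if "(i, j) \<in> ferrers xs" for i j
  proof -
    have "(0, j) \<in> ferrers xs"
      using ferrers_down_closed[OF assms that] by simp
    then show ?thesis
      by (auto simp: ferrers_def hd_conv_nth)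
  qed
  have col: "i < card {i. (i, j) \<in> ferrers xs} \<longleftrightarrow> (i, j) \<in> ferrers xs" for i j
    using ferrers_column[OF assms, of j] by blast
  have "(j, i) \<in> ferrers (conjugate xs) \<longleftrightarrow> (i, j) \<in> ferrers xs" for i j
  proof (cases "xs = []")
    case True
    then show ?thesis
      by (simp add: ferrers_def conjugate_def)
  next
    case False
    have "(j, i) \<in> ferrers (conjugate xs)
        \<longleftrightarrow> j < hd xs \<and> i < card {i. (i, j) \<in> ferrers xs}"
      unfolding ferrers_def[of "conjugate xs"] using False by (auto simp: conjugate_def)
    then show ?thesis
      using hd col by blast
  qed
  then show ?thesis
    by force
qed

lemma is_partition_conjugate:
  assumes "is_partition xs"
  shows "is_partition (conjugate xs)"
proof (cases "xs = []")
  case True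
  then show ?thesis
    by (simp add: is_partition_def conjugate_def)
next
  case False
  have "finite {i. (i, j) \<in> ferrers xs}" for j
    by (rule finite_subset[of _ "{..<length xs}"]) (auto simp: ferrers_def)
  moreover have "{i. (i, j') \<in> ferrers xs} \<subseteq> {i. (i, j) \<in> ferrers xs}" if "j \<le> j'" for j j'
    using ferrers_down_closed[OF assms] that by blast
  ultimately have mono: "card {i. (i, j') \<in> ferrers xs} \<le> card {i. (i, j) \<in> ferrers xs}"
    if "j \<le> j'" for j j'
    using that by (simp add: card_mono)
  have pos: "0 < card {i. (i, j) \<in> ferrers xs}" if "j < hd xs" for j
  proof -
    have "0 \<in> {i. (i, j) \<in> ferrers xs}"
      using False that by (simp add: ferrers_def hd_conv_nth)
    then show ?thesis
      using ferrers_column[OF assms, of j] by blast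
  qed
  show ?thesis
    using False mono pos by (auto simp: is_partition_def conjugate_def sorted_wrt_iff_nth_less)
qed

lemma finite_partitions_of: "finite {xs. is_partition xs \<and> sum_list xs = n}"
proof (rule finite_subset)
  have "length xs \<le> sum_list xs" if "\<forall>x\<in>set xs. 0 < x" for xs :: "nat list"
    using that by (induction xs) auto
  then show "{xs. is_partition xs \<and> sum_list xs = n} \<subseteq> {xs. set xs \<subseteq> {..n} \<and> length xs \<le> n}"
    by (auto simp: is_partition_def member_le_sum_list)
  show "finite {xs. set xs \<subseteq> {..n} \<and> length xs \<le> n}"
    by (rule finite_lists_length_le) simp
qed

end

theory Submission
  imports Defs "HOL-Library.FuncSet" "HOL-Computational_Algebra.Formal_Power_Series"
begin

text \<open>
  Encode a partition fitting into a \<open>K \<times> K\<close> square by its beta set \<open>X \<subseteq> {..<2 * K}\<close>, the set of the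
  numbers \<open>\<lambda>\<^sub>i + K - i\<close>. Its hook lengths are the differences \<open>x - y\<close> over the pairs with
  \<open>x \<in> X\<close>, \<open>y \<notin> X\<close>, \<open>y < x\<close>, and conjugation becomes \<open>x \<mapsto> 2 * K - 1 - x\<close> followed by complementation.
  Splitting \<open>X\<close> into residue classes modulo \<open>t\<close> gives the \<open>t\<close>-quotient, whose hooks are the hooks
  divisible by \<open>t\<close>; the condition that there are \<open>2 * n\<close> of them in a partition of \<open>2 * t * n\<close> says that
  the \<open>t\<close>-core is empty. Self-conjugacy exchanges the classes \<open>r\<close> and \<open>t - 1 - r\<close>, which are distinct
  because \<open>t\<close> is even, so that the partition is determined by \<open>t / 2\<close> arbitrary partitions of total
  size \<open>n\<close>. The sum of the squared inverse hook products over all partitions of \<open>j\<close> is \<open>1 / j!\<close>, by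
  the two branching rules of Young's lattice, which are partial fraction identities on beta sets;
  the coefficient of \<open>x\<^sup>n\<close> in \<open>exp x ^ (t / 2)\<close> then yields the result.
\<close>

section \<open>Partial fractions and products of hook lengths\<close>

text \<open>As a rational function of \<open>z\<close> the product tends to 1 at infinity and has
  simple poles at the points of \<open>X\<close>; the right-hand side is its expansion. A new pole
  \<open>w\<close> multiplies the old expansion by one factor, and the products of two poles are
  separated again.\<close>

lemma partial_fractions:
  fixes z a :: "'a::field"
  assumes "finite X" "z \<notin> X"
  shows "(\<Prod>y\<in>X. 1 + a / (z - y)) =
         1 + (\<Sum>x\<in>X. a / (z - x) * (\<Prod>y\<in>X - {x}. 1 + a / (x - y)))"
  using assms
proof (induction X arbitrary: z rule: finite_induct)
  case (insert w X)
  define B where "B x = (\<Prod>y\<in>X - {x}. 1 + a / (x - y))" for x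
  have z: "z \<noteq> w" "z \<notin> X" using insert.prems by auto
  have Bx: "(\<Prod>y\<in>insert w X - {x}. 1 + a / (x - y)) = (1 + a / (x - w)) * B x" if "x \<in> X" for x
  proof -
    have "insert w X - {x} = insert w (X - {x})" using that insert.hyps by auto
    then show ?thesis using insert.hyps by (simp add: B_def)
  qed
  \<comment> \<open>This decomposes \<open>1 / ((z - w) * (z - x))\<close> into one term for each of
    the two poles.\<close>
  have key: "(1 + a / (z - w)) * (a / (z - x) * B x)
      = a / (z - w) * (a / (w - x) * B x) + a / (z - x) * ((1 + a / (x - w)) * B x)"
    if "x \<in> X" for x
  proof -
    have "z - w \<noteq> 0" "z - x \<noteq> 0" "w - x \<noteq> 0" using z insert.hyps that by auto
    moreover have "a / (x - w) = - (a / (w - x))"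
      by (metis minus_diff_eq minus_divide_right)
    ultimately show ?thesis by (simp add: divide_simps) (simp add: algebra_simps)
  qed
  have "(\<Prod>y\<in>insert w X. 1 + a / (z - y)) =
      (1 + a / (z - w)) * (1 + (\<Sum>x\<in>X. a / (z - x) * B x))"
    using insert.hyps insert.IH[OF z(2)] by (simp add: B_def)
  also have "\<dots> = 1 + a / (z - w) + (\<Sum>x\<in>X. (1 + a / (z - w)) * (a / (z - x) * B x))"
    by (simp add: distrib_left sum_distrib_left)
  also have "\<dots> = 1 + a / (z - w) * (1 + (\<Sum>x\<in>X. a / (w - x) * B x))
      + (\<Sum>x\<in>X. a / (z - x) * ((1 + a / (x - w)) * B x))"
    unfolding distrib_left sum_distrib_left mult_1_right add.assoc sum.distrib[symmetric]
    using key by (simp cong: sum.cong)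
  \<comment> \<open>The induction hypothesis, taken at the point \<open>w\<close>, identifies the
    coefficient of the new pole.\<close>
  also have "1 + (\<Sum>x\<in>X. a / (w - x) * B x) = (\<Prod>y\<in>X. 1 + a / (w - y))"
    using insert.IH[OF insert.hyps(2)] by (simp add: B_def)
  also have "(\<Sum>x\<in>X. a / (z - x) * ((1 + a / (x - w)) * B x)) =
     (\<Sum>x\<in>X. a / (z - x) * (\<Prod>y\<in>insert w X - {x}. 1 + a / (x - y)))"
    by (simp add: Bx)
  finally show ?case using insert.hyps by (simp add: add.assoc insert_Diff_if)
qed simp

text \<open>Expand \<open>partial_fractions\<close> in powers of \<open>1 / z\<close>: up to a
  factor \<open>a\<close>, the coefficient of \<open>1 / z^2\<close> is the first identity and that
  of \<open>1 / z\<close> the second. The induction treats both jointly because the first draws on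
  the second.\<close>

lemma sum_partial_fraction_coeffs:
  fixes a :: "'a::field"
  assumes "finite X"
  shows "(\<Sum>x\<in>X. x * (\<Prod>y\<in>X - {x}. 1 + a / (x - y))) = \<Sum>X + a * of_nat (card X choose 2)"
    and "(\<Sum>x\<in>X. \<Prod>y\<in>X - {x}. 1 + a / (x - y)) = of_nat (card X)"
  using assms
proof (induction X rule: finite_induct)
  case (insert w X)
  define B where "B x = (\<Prod>y\<in>X - {x}. 1 + a / (x - y))" for x
  have Bx: "(\<Prod>y\<in>insert w X - {x}. 1 + a / (x - y)) = (1 + a / (x - w)) * B x" if "x \<in> X" for x
  proof -
    have "insert w X - {x} = insert w (X - {x})" using that insert.hyps by auto
    then show ?thesis using insert.hyps by (simp add: B_def)
  qed
  \<comment> \<open>The coefficient at the new point is itself expanded, so that its terms pair with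
    those of the old points; in \<open>key\<close>, \<open>x / (x - w)\<close> and
    \<open>w / (w - x)\<close> then add up to 1.\<close>
  have Bw: "(\<Prod>y\<in>insert w X - {w}. 1 + a / (w - y)) = 1 + (\<Sum>x\<in>X. a / (w - x) * B x)"
    using partial_fractions[OF insert.hyps, of a] insert.hyps by (simp add: B_def)
  have neg: "a / (x - w) = - (a / (w - x))" for x
    by (metis minus_diff_eq minus_divide_right)
  have key: "x * ((1 + a / (x - w)) * B x) + w * (a / (w - x) * B x) = x * B x + a * B x"
    if "x \<in> X" for x
  proof -
    have "w - x \<noteq> 0" using insert.hyps that by auto
    then show ?thesis unfolding neg by (simp add: divide_simps) (simp add: algebra_simps)
  qed
  have "(\<Sum>x\<in>insert w X. x * (\<Prod>y\<in>insert w X - {x}. 1 + a / (x - y)))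
      = w + (\<Sum>x\<in>X. x * ((1 + a / (x - w)) * B x) + w * (a / (w - x) * B x))"
    by (subst sum.insert[OF insert.hyps], unfold Bw)
      (simp add: Bx sum.distrib distrib_left sum_distrib_left)
  also have "\<dots> = w + (\<Sum>x\<in>X. x * B x + a * B x)"
    using key by (simp cong: sum.cong)
  also have "\<dots> = w + (\<Sum>x\<in>X. x * B x) + a * (\<Sum>x\<in>X. B x)"
    by (simp add: sum.distrib sum_distrib_left)
  also have "\<dots> = \<Sum>(insert w X) + a * of_nat (card (insert w X) choose 2)"
    using insert by (simp add: B_def numeral_2_eq_2 algebra_simps)
  finally show "(\<Sum>x\<in>insert w X. x * (\<Prod>y\<in>insert w X - {x}. 1 + a / (x - y)))
     = \<Sum>(insert w X) + a * of_nat (card (insert w X) choose 2)" .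
  have "(\<Sum>x\<in>insert w X. \<Prod>y\<in>insert w X - {x}. 1 + a / (x - y))
      = 1 + (\<Sum>x\<in>X. (1 + a / (x - w)) * B x + (a / (w - x) * B x))"
    by (subst sum.insert[OF insert.hyps], unfold Bw) (simp add: Bx sum.distrib)
  also have "\<dots> = 1 + (\<Sum>x\<in>X. B x)"
    unfolding neg by (simp add: algebra_simps)
  finally show "(\<Sum>x\<in>insert w X. \<Prod>y\<in>insert w X - {x}. 1 + a / (x - y)) = of_nat (card (insert w X))"
    using insert by (simp add: B_def)
qed (simp_all add: numeral_2_eq_2)

section \<open>Inversions, weights and Vandermonde products\<close>

definition inversions :: "nat set \<Rightarrow> (nat \<times> nat) set" where
  "inversions X = {(x, y). x \<in> X \<and> y \<notin> X \<and> y < x}"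

text \<open>For a beta set this is the inverse of the product of all hook lengths.\<close>

definition weight :: "nat set \<Rightarrow> real" where
  "weight X = (\<Prod>(x, y)\<in>inversions X. 1 / (real x - real y))"

lemma inversions_Sigma: "inversions X = (SIGMA x:X. {..<x} - X)"
  by (auto simp: inversions_def)

lemma finite_inversions [simp]: "finite X \<Longrightarrow> finite (inversions X)"
  by (simp add: inversions_Sigma)

lemma sum_card_below:
  fixes X :: "nat set"
  assumes "finite X"
  shows "(\<Sum>x\<in>X. card (X \<inter> {..<x})) = card X choose 2"
  using assms
proof (induction X rule: finite_linorder_max_induct)
  case (insert b A)
  have "(\<Sum>x\<in>A. card (insert b A \<inter> {..<x})) = (\<Sum>x\<in>A. card (A \<inter> {..<x}))"
    using insert.hyps by (intro sum.cong) (auto simp: Int_insert_left)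
  moreover have "insert b A \<inter> {..<b} = A" using insert.hyps by auto
  moreover have "b \<notin> A" using insert.hyps by auto
  ultimately show ?case using insert by (simp add: numeral_2_eq_2)
qed simp

text \<open>Each of the \<open>x\<close> numbers below \<open>x \<in> X\<close> is a gap, giving an
  inversion, or an element, giving a pair inside \<open>X\<close>. For a fixed number of beads, the
  size of the partition is thus read off from the sum of the positions.\<close>

lemma card_inversions:
  assumes "finite X"
  shows "card (inversions X) + (card X choose 2) = \<Sum>X"
proof -
  have "card ({..<x} - X) + card (X \<inter> {..<x}) = x" for x
    using card_Un_disjoint[of "{..<x} - X" "X \<inter> {..<x}"] assms
    by (simp add: Un_commute Int_commute Int_Diff_Un disjoint_iff)
       (metis Int_Diff_Un Int_commute Un_commute card_lessThan)
  then have "(\<Sum>x\<in>X. card ({..<x} - X)) + (\<Sum>x\<in>X. card (X \<inter> {..<x})) = \<Sum>X"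
    by (simp add: sum.distrib[symmetric])
  then show ?thesis
    using assms by (simp add: inversions_Sigma sum_card_below)
qed

definition vandermonde :: "nat set \<Rightarrow> real" where
  "vandermonde X = (\<Prod>x\<in>X. \<Prod>y\<in>X \<inter> {..<x}. real x - real y)"

lemma fact_eq_prod_diff: "fact x = (\<Prod>y<x. real x - real y)"
proof -
  have "(\<Prod>y<x. real x - real y) = (\<Prod>y<x. real (x - y))"
    by (intro prod.cong) auto
  also have "\<dots> = real (\<Prod>{1..x})"
    unfolding of_nat_prod by (rule prod.reindex_bij_witness[of _ "\<lambda>i. x - i" "\<lambda>i. x - i"]) auto
  finally show ?thesis by (simp add: fact_prod)
qed

text \<open>\<open>fact x\<close> is the product of \<open>x - y\<close> over all
  \<open>y < x\<close>; dividing out the factors with \<open>y \<in> X\<close> leaves the gaps. This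
  is Frobenius' form of the hook product.\<close>

lemma weight_eq_vandermonde:
  assumes "finite X"
  shows "weight X = vandermonde X / (\<Prod>x\<in>X. fact x)"
proof -
  have *: "(\<Prod>y\<in>{..<x} - X. 1 / (real x - real y)) = (\<Prod>y\<in>X \<inter> {..<x}. real x - real y) / fact x" for x
  proof -
    have "fact x = (\<Prod>y\<in>X \<inter> {..<x}. real x - real y) * (\<Prod>y\<in>{..<x} - X. real x - real y)"
      unfolding fact_eq_prod_diff
      by (subst prod.union_disjoint[symmetric]) (auto intro!: prod.cong)
    moreover have "(fact x :: real) \<noteq> 0" by simp
    ultimately show ?thesis
      by (simp add: prod_dividef field_simps)
  qed
  have "weight X = (\<Prod>x\<in>X. \<Prod>y\<in>{..<x} - X. 1 / (real x - real y))"
    unfolding weight_def inversions_Sigma using assms by (subst prod.Sigma) auto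
  then show ?thesis
    unfolding * vandermonde_def by (simp add: prod_dividef)
qed

text \<open>Differences to smaller \<open>y\<close> arise from the index \<open>w\<close>, those to
  larger \<open>y\<close> from the index \<open>y\<close>; the absolute value merges the two
  cases.\<close>

lemma vandermonde_insert:
  assumes "finite Z" "w \<notin> Z"
  shows "vandermonde (insert w Z) = vandermonde Z * (\<Prod>y\<in>Z. \<bar>real w - real y\<bar>)"
proof -
  have 1: "(\<Prod>y\<in>insert w Z \<inter> {..<w}. real w - real y) = (\<Prod>y\<in>Z. if y < w then real w - real y else 1)"
  proof -
    have "insert w Z \<inter> {..<w} = {y\<in>Z. y < w}" by auto
    then show ?thesis using assms(1) by (simp add: prod.inter_filter)
  qed
  have 2: "(\<Prod>y\<in>insert w Z \<inter> {..<x}. real x - real y) =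
     (if w < x then real x - real w else 1) * (\<Prod>y\<in>Z \<inter> {..<x}. real x - real y)" for x
    using assms by (auto simp: Int_insert_left)
  have "vandermonde (insert w Z) = (\<Prod>y\<in>Z. if y < w then real w - real y else 1) *
      ((\<Prod>x\<in>Z. if w < x then real x - real w else 1) * vandermonde Z)"
    unfolding vandermonde_def by (subst prod.insert[OF assms], unfold 1) (simp only: 2 prod.distrib)
  also have "\<dots> = vandermonde Z * (\<Prod>y\<in>Z. (if y < w then real w - real y else 1) * (if w < y then real y - real w else 1))"
    by (simp add: prod.distrib mult_ac)
  also have "(\<Prod>y\<in>Z. (if y < w then real w - real y else 1) * (if w < y then real y - real w else 1))
     = (\<Prod>y\<in>Z. \<bar>real w - real y\<bar>)"
  proof (intro prod.cong refl)
    fix y assume "y \<in> Z"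
    then have "y \<noteq> w" using assms(2) by auto
    then show "(if y < w then real w - real y else 1) * (if w < y then real y - real w else 1)
      = \<bar>real w - real y\<bar>"
      by (cases "y < w") auto
  qed
  finally show ?thesis .
qed

section \<open>Sums of squared inverse hook products\<close>

text \<open>For \<open>y = Suc x\<close> the move adds a box to the partition, for
  \<open>x = Suc y\<close> it removes one.\<close>

definition move :: "nat \<Rightarrow> nat \<Rightarrow> nat set \<Rightarrow> nat set" where
  "move x y X = insert y (X - {x})"

text \<open>Both sets arise from \<open>X - {x}\<close> by one insertion, so the Vandermonde product
  and the factorials of the common part cancel.\<close>

lemma weight_move:
  assumes "finite X" "x \<in> X" "y \<notin> X"
  shows "weight (move x y X) * fact y * (\<Prod>z\<in>X - {x}. \<bar>real x - real z\<bar>)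
       = weight X * fact x * (\<Prod>z\<in>X - {x}. \<bar>real y - real z\<bar>)"
proof -
  let ?Z = "X - {x}"
  have X: "X = insert x ?Z" and Z: "finite ?Z" "x \<notin> ?Z" "y \<notin> ?Z"
    using assms by auto
  have F: "(\<Prod>z\<in>?Z. fact z) \<noteq> (0 :: real)" using Z(1) by simp
  have 1: "weight (insert w ?Z) * fact w * (\<Prod>z\<in>?Z. fact z) = vandermonde ?Z * (\<Prod>z\<in>?Z. \<bar>real w - real z\<bar>)"
    if "w \<notin> ?Z" for w
    using Z(1) F that by (simp add: weight_eq_vandermonde vandermonde_insert)
  have "(weight (insert y ?Z) * fact y * (\<Prod>z\<in>?Z. fact z)) * (\<Prod>z\<in>?Z. \<bar>real x - real z\<bar>)
     = (weight (insert x ?Z) * fact x * (\<Prod>z\<in>?Z. fact z)) * (\<Prod>z\<in>?Z. \<bar>real y - real z\<bar>)"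
    unfolding 1[OF Z(2)] 1[OF Z(3)] by simp
  then show ?thesis using F X[symmetric] by (simp add: move_def)
qed

text \<open>No \<open>z\<close> lies strictly between adjacent positions, so
  \<open>real x - real z\<close> and \<open>real y - real z\<close> have the same sign and their
  quotient needs no absolute value.\<close>

lemma abs_div_adjacent:
  assumes "x \<noteq> z" "y \<noteq> z" "y = Suc x \<or> x = Suc y"
  shows "\<bar>real y - real z\<bar> = \<bar>real x - real z\<bar> * (1 + (real y - real x) / (real x - real z))"
proof -
  have "0 \<le> (real y - real z) / (real x - real z)"
    using assms by (auto simp: zero_le_divide_iff)
  moreover have "1 + (real y - real x) / (real x - real z) = (real y - real z) / (real x - real z)"
    using assms(1) by (simp add: field_simps)
  ultimately have "\<bar>1 + (real y - real x) / (real x - real z)\<bar> = 1 + (real y - real x) / (real x - real z)"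
    using assms(1) by (metis abs_of_nonneg)
  moreover have "real y - real z = (real x - real z) * (1 + (real y - real x) / (real x - real z))"
    using assms(1) by (simp add: field_simps)
  ultimately show ?thesis
    by (metis abs_mult)
qed

text \<open>The ratio of the weights becomes a partial fraction coefficient, with
  \<open>a = 1\<close> for a move up and \<open>a = - 1\<close> for a move down.\<close>

lemma weight_move_adjacent:
  assumes "finite X" "x \<in> X" "y \<notin> X" "y = Suc x \<or> x = Suc y"
  shows "weight (move x y X) * fact y
       = weight X * fact x * (\<Prod>z\<in>X - {x}. 1 + (real y - real x) / (real x - real z))"
proof -
  have nz: "(\<Prod>z\<in>X - {x}. \<bar>real x - real z\<bar>) \<noteq> 0"
    using assms(1) by auto
  have "(\<Prod>z\<in>X - {x}. \<bar>real y - real z\<bar>) = (\<Prod>z\<in>X - {x}. \<bar>real x - real z\<bar> * (1 + (real y - real x) / (real x - real z)))"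
    using assms by (intro prod.cong refl abs_div_adjacent) auto
  then show ?thesis
    using weight_move[OF assms(1-3)] nz by (simp add: prod.distrib)
qed

text \<open>Evaluate the partial fraction expansion with \<open>a = 1\<close> at \<open>z = - 1\<close>, where the product vanishes.
  Moves onto an occupied position contribute a zero factor.\<close>

lemma sum_weight_up:
  assumes "finite X" "0 \<in> X"
  shows "(\<Sum>x | x \<in> X \<and> Suc x \<notin> X. weight (move x (Suc x) X)) = weight X"
proof -
  define B where "B x = (\<Prod>z\<in>X - {x}. 1 + 1 / (real x - real z))" for x
  have B0: "B x = 0" if "Suc x \<in> X" for x
    unfolding B_def using assms(1) that by (intro prod_zero bexI[of _ "Suc x"]) auto
  have reindex: "(\<Prod>y\<in>real ` X - {real x}. 1 + 1 / (real x - y)) = B x" for x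
  proof -
    have "real ` X - {real x} = real ` (X - {x})" by auto
    then show ?thesis by (simp add: B_def prod.reindex)
  qed
  have "(\<Prod>y\<in>real ` X. 1 + 1 / (- 1 - y)) = 1 + (\<Sum>x\<in>real ` X. 1 / (- 1 - x) * (\<Prod>y\<in>real ` X - {x}. 1 + 1 / (x - y)))"
    using assms(1) by (intro partial_fractions) (auto simp: image_iff)
  \<comment> \<open>The bead at 0 contributes the factor \<open>1 + 1 / (- 1)\<close>.\<close>
  also have "(\<Prod>y\<in>real ` X. 1 + 1 / (- 1 - y)) = 0"
    using assms by (intro prod_zero bexI[of _ 0]) auto
  also have "(\<Sum>x\<in>real ` X. 1 / (- 1 - x) * (\<Prod>y\<in>real ` X - {x}. 1 + 1 / (x - y))) = (\<Sum>x\<in>X. 1 / (- 1 - real x) * B x)"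
    by (simp add: sum.reindex reindex)
  also have "\<dots> = - (\<Sum>x\<in>X. B x / (1 + real x))"
    unfolding sum_negf[symmetric] by (intro sum.cong refl) (simp add: field_simps)
  finally have *: "(\<Sum>x\<in>X. B x / (1 + real x)) = 1" by simp
  have "(\<Sum>x | x \<in> X \<and> Suc x \<notin> X. weight (move x (Suc x) X))
      = (\<Sum>x | x \<in> X \<and> Suc x \<notin> X. weight X * (B x / (1 + real x)))"
  proof (intro sum.cong refl)
    fix x assume "x \<in> {x. x \<in> X \<and> Suc x \<notin> X}"
    then have "weight (move x (Suc x) X) * fact (Suc x) = weight X * fact x * B x"
      using weight_move_adjacent[OF assms(1), of x "Suc x"] by (simp add: B_def)
    then have "fact x * (weight (move x (Suc x) X) * (1 + real x)) = fact x * (weight X * B x)"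
      by (simp add: algebra_simps)
    then have "weight (move x (Suc x) X) * (1 + real x) = weight X * B x"
      by simp
    then show "weight (move x (Suc x) X) = weight X * (B x / (1 + real x))"
      by (simp add: field_simps)
  qed
  also have "\<dots> = (\<Sum>x\<in>X. weight X * (B x / (1 + real x)))"
    using assms(1) by (intro sum.mono_neutral_left) (auto simp: B0)
  also have "\<dots> = weight X" unfolding sum_distrib_left[symmetric] * by simp
  finally show ?thesis .
qed

text \<open>With \<open>a = - 1\<close>, the first identity of
  \<open>sum_partial_fraction_coeffs\<close> has the value
  \<open>\<Sum>X - (card X choose 2)\<close>, which is the number of inversions. Its terms are the
  ratios of the weights before and after a downward move.\<close>

lemma sum_weight_down:
  assumes "finite X"
  shows "(\<Sum>x | Suc x \<in> X \<and> x \<notin> X. weight (move (Suc x) x X)) = real (card (inversions X)) * weight X"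
proof -
  define B where "B x = (\<Prod>z\<in>X - {x}. 1 + (- 1) / (real x - real z))" for x
  have B0: "B (Suc x) = 0" if "x \<in> X" for x
    unfolding B_def using assms(1) that by (intro prod_zero bexI[of _ x]) auto
  have reindex: "(\<Prod>y\<in>real ` X - {real x}. 1 - 1 / (real x - y)) = B x" for x
  proof -
    have "real ` X - {real x} = real ` (X - {x})" by auto
    then show ?thesis by (simp add: B_def prod.reindex)
  qed
  have "(\<Sum>x\<in>real ` X. x * (\<Prod>y\<in>real ` X - {x}. 1 + (- 1) / (x - y)))
     = \<Sum>(real ` X) + (- 1) * of_nat (card (real ` X) choose 2)"
    using assms(1) by (intro sum_partial_fraction_coeffs) auto
  then have "(\<Sum>x\<in>X. real x * B x) = real (\<Sum>X) - real (card X choose 2)"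
    by (simp add: sum.reindex reindex card_image)
  then have *: "(\<Sum>x\<in>X. real x * B x) = real (card (inversions X))"
    unfolding card_inversions[OF assms, symmetric] by simp
  have "(\<Sum>x | Suc x \<in> X \<and> x \<notin> X. weight (move (Suc x) x X))
      = (\<Sum>x | Suc x \<in> X \<and> x \<notin> X. weight X * (real (Suc x) * B (Suc x)))"
  proof (intro sum.cong refl)
    fix x assume "x \<in> {x. Suc x \<in> X \<and> x \<notin> X}"
    then have "weight (move (Suc x) x X) * fact x = weight X * fact (Suc x) * B (Suc x)"
      using weight_move_adjacent[OF assms(1), of "Suc x" x] by (simp add: B_def)
    then have "fact x * weight (move (Suc x) x X) = fact x * (weight X * (real (Suc x) * B (Suc x)))"
      by (simp add: algebra_simps)
    then show "weight (move (Suc x) x X) = weight X * (real (Suc x) * B (Suc x))"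
      by simp
  qed
  also have "\<dots> = (\<Sum>x\<in>Suc ` {x. Suc x \<in> X \<and> x \<notin> X}. weight X * (real x * B x))"
    by (simp add: sum.reindex)
  also have "\<dots> = (\<Sum>x\<in>X. weight X * (real x * B x))"
  proof (intro sum.mono_neutral_left ballI)
    fix x assume x: "x \<in> X - Suc ` {x. Suc x \<in> X \<and> x \<notin> X}"
    show "weight X * (real x * B x) = 0"
      \<comment> \<open>A bead at 0 is removed by the factor \<open>real x\<close>, a bead with an
        occupied position below it by a zero factor of \<open>B\<close>.\<close>
      using x by (cases x) (auto simp: B0)
  qed (use assms in auto)
  also have "\<dots> = real (card (inversions X)) * weight X"
    unfolding sum_distrib_left[symmetric] * by simp
  finally show ?thesis .
qed

text \<open>These are the beta sets, with \<open>k\<close> beads, of the partitions of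
  \<open>n\<close> into at most \<open>k\<close> parts.\<close>

definition bead_sets :: "nat \<Rightarrow> nat \<Rightarrow> nat set set" where
  "bead_sets k n = {X. finite X \<and> card X = k \<and> card (inversions X) = n}"

text \<open>At least \<open>Suc x - k\<close> of the positions up to a bead \<open>x\<close> are
  gaps, and each of them forms an inversion with \<open>x\<close>.\<close>

lemma bead_sets_subset:
  assumes "X \<in> bead_sets k n"
  shows "X \<subseteq> {..<k + n}"
proof
  fix x assume x: "x \<in> X"
  have fin: "finite X" and c: "card X = k" "card (inversions X) = n"
    using assms by (auto simp: bead_sets_def)
  have "card ({..<Suc x} - X) \<le> card (inversions X)"
  proof (rule card_inj_on_le[of "Pair x"])
    show "Pair x ` ({..<Suc x} - X) \<subseteq> inversions X"
      using x by (auto simp: inversions_def less_Suc_eq)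
  qed (use fin in \<open>auto simp: inj_on_def\<close>)
  moreover have "Suc x - card X \<le> card ({..<Suc x} - X)"
    using diff_card_le_card_Diff[OF fin, of "{..<Suc x}"] by simp
  ultimately show "x \<in> {..<k + n}" using c by simp
qed

lemma finite_bead_sets [simp]: "finite (bead_sets k n)"
  by (rule finite_subset[of _ "Pow {..<k + n}"]) (use bead_sets_subset in auto)

text \<open>A gap at 0 would form an inversion with each of the \<open>k\<close> beads. This
  supplies the hypothesis of \<open>sum_weight_up\<close>.\<close>

lemma zero_in_bead_set:
  assumes "X \<in> bead_sets k n" "n < k"
  shows "0 \<in> X"
proof (rule ccontr)
  assume 0: "0 \<notin> X"
  have fin: "finite X" and c: "card X = k" "card (inversions X) = n"
    using assms by (auto simp: bead_sets_def)
  have "card X \<le> card (inversions X)"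
  proof (rule card_inj_on_le[of "\<lambda>x. (x, 0)"])
    show "(\<lambda>x. (x, 0)) ` X \<subseteq> inversions X"
      using 0 by (auto simp: inversions_def intro!: Nat.gr0I)
  qed (use fin in \<open>auto simp: inj_on_def\<close>)
  then show False using c assms(2) by simp
qed

lemma bead_sets_0: "bead_sets k 0 = {{..<k}}"
proof -
  have "X = {..<k}" if "X \<in> bead_sets k 0" for X
    using bead_sets_subset[OF that] that by (intro card_subset_eq) (auto simp: bead_sets_def)
  moreover have "inversions {..<k} = {}" by (auto simp: inversions_def)
  ultimately show ?thesis by (auto simp: bead_sets_def)
qed

text \<open>The number of beads is unchanged, so by \<open>card_inversions\<close> the number of
  inversions changes exactly as the sum of the positions does.\<close>

lemma move_bead_set:
  assumes "X \<in> bead_sets k n" "x \<in> X" "y \<notin> X"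
  shows "finite (move x y X)" "card (move x y X) = k"
    "card (inversions (move x y X)) + x = n + y"
proof -
  have fin: "finite X" and c: "card X = k" "card (inversions X) = n"
    using assms by (auto simp: bead_sets_def)
  show f: "finite (move x y X)" using fin by (simp add: move_def)
  have "card X > 0" using fin assms by (auto simp: card_gt_0_iff)
  then show k: "card (move x y X) = k" using fin assms c by (simp add: move_def)
  have "\<Sum>(move x y X) + x = \<Sum>X + y"
    using fin assms by (simp add: move_def sum.remove[of X x])
  then show "card (inversions (move x y X)) + x = n + y"
    using card_inversions[OF fin] card_inversions[OF f] k c by simp
qed

text \<open>Count the covering pairs of Young's lattice from above and from below, weighted by the
  product of the two weights.\<close>

lemma sum_weight_square_Suc:
  assumes "n < k"
  shows "real (Suc n) * (\<Sum>X\<in>bead_sets k (Suc n). (weight X)\<^sup>2) = (\<Sum>X\<in>bead_sets k n. (weight X)\<^sup>2)"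
proof -
  have "real (Suc n) * (\<Sum>X\<in>bead_sets k (Suc n). (weight X)\<^sup>2)
      = (\<Sum>X\<in>bead_sets k (Suc n). weight X * (real (card (inversions X)) * weight X))"
    by (simp add: sum_distrib_left power2_eq_square bead_sets_def mult_ac)
  also have "\<dots> = (\<Sum>X\<in>bead_sets k (Suc n). \<Sum>x | Suc x \<in> X \<and> x \<notin> X. weight X * weight (move (Suc x) x X))"
    by (intro sum.cong refl, subst sum_weight_down[symmetric]) (auto simp: bead_sets_def sum_distrib_left)
  also have "\<dots> = (\<Sum>(X, x)\<in>(SIGMA X:bead_sets k (Suc n). {x. Suc x \<in> X \<and> x \<notin> X}). weight X * weight (move (Suc x) x X))"
  proof (rule sum.Sigma)
    show "\<forall>X\<in>bead_sets k (Suc n). finite {x. Suc x \<in> X \<and> x \<notin> X}"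
      using finite_vimageI[of _ Suc] by (auto simp: bead_sets_def vimage_def)
  qed simp
  also have "\<dots> = (\<Sum>(X, x)\<in>(SIGMA X:bead_sets k n. {x. x \<in> X \<and> Suc x \<notin> X}). weight (move x (Suc x) X) * weight X)"
  proof (rule sum.reindex_bij_witness[of _ "\<lambda>(X, x). (move x (Suc x) X, x)" "\<lambda>(X, x). (move (Suc x) x X, x)"], goal_cases)
    case (1 a)
    then obtain X x where a: "a = (X, x)" "Suc x \<in> X" "x \<notin> X" by auto
    then have "move x (Suc x) (move (Suc x) x X) = X" by (auto simp: move_def)
    with a show ?case by simp
  next
    case (2 a)
    then obtain X x where a: "a = (X, x)" and X: "X \<in> bead_sets k (Suc n)" "Suc x \<in> X" "x \<notin> X" by auto
    have "move (Suc x) x X \<in> bead_sets k n"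
      using move_bead_set[OF X] by (simp add: bead_sets_def)
    moreover have "x \<in> move (Suc x) x X" "Suc x \<notin> move (Suc x) x X" by (auto simp: move_def)
    ultimately show ?case by (simp add: a)
  next
    case (3 a)
    then obtain X x where a: "a = (X, x)" "x \<in> X" "Suc x \<notin> X" by auto
    then have "move (Suc x) x (move x (Suc x) X) = X" by (auto simp: move_def)
    with a show ?case by simp
  next
    case (4 a)
    then obtain X x where a: "a = (X, x)" and X: "X \<in> bead_sets k n" "x \<in> X" "Suc x \<notin> X" by auto
    have "move x (Suc x) X \<in> bead_sets k (Suc n)"
      using move_bead_set[OF X] by (simp add: bead_sets_def)
    moreover have "Suc x \<in> move x (Suc x) X" "x \<notin> move x (Suc x) X" by (auto simp: move_def)
    ultimately show ?case by (simp add: a)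
  next
    case (5 a)
    then obtain X x where a: "a = (X, x)" "Suc x \<in> X" "x \<notin> X" by auto
    then have "move x (Suc x) (move (Suc x) x X) = X" by (auto simp: move_def)
    with a show ?case by (simp add: mult.commute)
  qed
  also have "\<dots> = (\<Sum>X\<in>bead_sets k n. \<Sum>x | x \<in> X \<and> Suc x \<notin> X. weight (move x (Suc x) X) * weight X)"
    by (rule sum.Sigma[symmetric, OF finite_bead_sets]) (auto simp: bead_sets_def)
  \<comment> \<open>As \<open>n < k\<close>, position 0 is occupied: there is room for a new row,
    and the upward rule applies.\<close>
  also have "\<dots> = (\<Sum>X\<in>bead_sets k n. (weight X)\<^sup>2)"
    using zero_in_bead_set[OF _ assms]
    by (intro sum.cong refl) (simp add: sum_distrib_right[symmetric] sum_weight_up bead_sets_def power2_eq_square)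
  finally show ?thesis .
qed

text \<open>This is the identity that the squared numbers of standard tableaux of size
  \<open>n\<close> sum to \<open>n!\<close>, divided by the square of \<open>n!\<close>. The bound
  \<open>n \<le> k\<close> admits every partition of \<open>n\<close>.\<close>

lemma sum_weight_square:
  assumes "n \<le> k"
  shows "(\<Sum>X\<in>bead_sets k n. (weight X)\<^sup>2) = 1 / fact n"
  using assms
proof (induction n)
  case 0
  have "inversions {..<k} = {}" by (auto simp: inversions_def)
  then show ?case by (simp add: bead_sets_0 weight_def)
next
  case (Suc n)
  then have "real (Suc n) * (\<Sum>X\<in>bead_sets k (Suc n). (weight X)\<^sup>2) = 1 / fact n"
    using sum_weight_square_Suc[of n k] by simp
  then have "(\<Sum>X\<in>bead_sets k (Suc n). (weight X)\<^sup>2) = (1 / fact n) / real (Suc n)"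
    by (simp add: eq_divide_eq mult.commute del: of_nat_Suc)
  then show ?case by (simp add: mult.commute)
qed

section \<open>Coefficients of powers of the exponential series\<close>

lemma fps_power_nth_cong:
  fixes F G :: "'a::comm_semiring_1 fps"
  assumes "\<And>j. j \<le> n \<Longrightarrow> fps_nth F j = fps_nth G j"
  shows "fps_nth (F ^ s) n = fps_nth (G ^ s) n"
  using assms
proof (induction s arbitrary: n)
  case (Suc s)
  then show ?case by (simp add: fps_mult_nth)
qed simp

text \<open>The generating polynomial \<open>F\<close> of \<open>g\<close> by \<open>c\<close>
  agrees with the exponential series up to degree \<open>n\<close>, so \<open>F ^ s\<close> has the
  same \<open>n\<close>-th coefficient as \<open>exp (s * x)\<close>. Expanding \<open>F ^ s\<close>
  gives the sum over tuples.\<close>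

lemma sum_PiE_exponential:
  fixes g :: "'b \<Rightarrow> real" and c :: "'b \<Rightarrow> nat"
  assumes "finite A" "\<And>j. j \<le> n \<Longrightarrow> (\<Sum>X | X \<in> A \<and> c X = j. g X) = 1 / fact j"
  shows "(\<Sum>f | f \<in> PiE {..<s} (\<lambda>_. A) \<and> (\<Sum>r<s. c (f r)) = n. \<Prod>r<s. g (f r)) = real s ^ n / fact n"
proof -
  define F :: "real fps" where "F = (\<Sum>X\<in>A. fps_const (g X) * fps_X ^ c X)"
  have F_nth: "fps_nth F j = (\<Sum>X | X \<in> A \<and> c X = j. g X)" for j
  proof -
    have "fps_nth F j = (\<Sum>X\<in>A. if c X = j then g X else 0)"
      unfolding F_def fps_sum_nth by (intro sum.cong) auto
    then show ?thesis using assms(1) by (simp add: sum.inter_filter)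
  qed
  have summand: "fps_nth (\<Prod>r<s. fps_const (g (f r)) * fps_X ^ c (f r)) n = (if (\<Sum>r<s. c (f r)) = n then \<Prod>r<s. g (f r) else 0)" for f
  proof -
    have "(\<Prod>r<s. fps_const (g (f r)) * fps_X ^ c (f r)) = fps_const (\<Prod>r<s. g (f r)) * fps_X ^ (\<Sum>r<s. c (f r))"
      by (induction s) (simp_all add: power_add mult_ac flip: fps_const_mult)
    then show ?thesis by auto
  qed
  have fin: "finite (PiE {..<s} (\<lambda>_. A))" using assms(1) by (intro finite_PiE) auto
  have "F ^ s = (\<Prod>r<s. \<Sum>X\<in>A. fps_const (g X) * fps_X ^ c X)"
    by (simp add: F_def)
  also have "\<dots> = (\<Sum>f\<in>PiE {..<s} (\<lambda>_. A). \<Prod>r<s. fps_const (g (f r)) * fps_X ^ c (f r))"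
    using assms(1) by (intro prod_sum_PiE) auto
  finally have "fps_nth (F ^ s) n = (\<Sum>f\<in>PiE {..<s} (\<lambda>_. A). if (\<Sum>r<s. c (f r)) = n then \<Prod>r<s. g (f r) else 0)"
    by (simp add: fps_sum_nth summand)
  also have "\<dots> = (\<Sum>f | f \<in> PiE {..<s} (\<lambda>_. A) \<and> (\<Sum>r<s. c (f r)) = n. \<Prod>r<s. g (f r))"
    using fin by (simp add: sum.inter_filter)
  finally show ?thesis
    using fps_power_nth_cong[of n F "fps_exp 1" s] assms(2) by (simp add: F_nth fps_exp_power_mult)
qed

section \<open>Residue classes of beads\<close>

text \<open>A runner of the \<open>t\<close>-abacus, rescaled so that it is itself a set of
  beads.\<close>

definition runner :: "nat \<Rightarrow> nat \<Rightarrow> nat set \<Rightarrow> nat set" where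
  "runner t r X = {q. t * q + r \<in> X}"

definition inversions_mod :: "nat \<Rightarrow> nat set \<Rightarrow> (nat \<times> nat) set" where
  "inversions_mod t X = {(x, y) \<in> inversions X. t dvd x - y}"

lemma finite_runner [simp]:
  assumes "finite X" "0 < t"
  shows "finite (runner t r X)"
proof -
  have "finite ((\<lambda>q. t * q + r) -` X)"
    using assms by (intro finite_vimageI) (auto simp: inj_on_def)
  then show ?thesis by (simp add: runner_def vimage_def)
qed

lemma sum_runners:
  fixes g :: "nat \<Rightarrow> 'a::comm_monoid_add"
  assumes "finite X" "0 < t"
  shows "(\<Sum>x\<in>X. g x) = (\<Sum>r<t. \<Sum>q\<in>runner t r X. g (t * q + r))"
proof -
  have "(\<Sum>x\<in>X. g x) = (\<Sum>(r, q)\<in>(SIGMA r:{..<t}. runner t r X). g (t * q + r))"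
    by (rule sum.reindex_bij_witness[of _ "\<lambda>(r, q). t * q + r" "\<lambda>x. (x mod t, x div t)"])
      (use assms in \<open>auto simp: runner_def\<close>)
  then show ?thesis using assms by (simp add: sum.Sigma)
qed

lemma card_eq_sum_runners:
  assumes "finite X" "0 < t"
  shows "card X = (\<Sum>r<t. card (runner t r X))"
  using sum_runners[OF assms, of "\<lambda>_. 1::nat"] by simp

text \<open>Congruent positions lie on the same runner, and division by \<open>t\<close> keeps their
  order.\<close>

lemma bij_betw_inversions_mod:
  assumes "0 < t"
  shows "bij_betw (\<lambda>(r, p, q). (t * p + r, t * q + r))
    (SIGMA r:{..<t}. inversions (runner t r X)) (inversions_mod t X)"
proof -
  have eq: "t * (y div t) + x mod t = y" if "y < x" "t dvd x - y" for x y
  proof -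
    have "x mod t = y mod t"
      using that by (simp add: mod_eq_dvd_iff_nat)
    then show ?thesis by simp
  qed
  have lt: "y div t < x div t" if "y < x" "t dvd x - y" for x y
  proof (rule ccontr)
    assume "\<not> y div t < x div t"
    then have "t * (x div t) \<le> t * (y div t)" by simp
    then show False using eq[OF that] that(1) mult_div_mod_eq[of t x] by linarith
  qed
  show ?thesis
  proof (rule bij_betw_byWitness[where f' = "\<lambda>(x, y). (x mod t, x div t, y div t)"], goal_cases)
    case 2
    show ?case using eq by (auto simp: inversions_mod_def inversions_def)
  next
    case 3
    then show ?case using assms
      by (auto simp: inversions_mod_def inversions_def runner_def simp flip: right_diff_distrib')
  next
    case 4
    show ?case
      using assms by (auto simp: inversions_mod_def inversions_def runner_def eq lt)
  qed (use assms in auto)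
qed

lemma card_inversions_mod:
  assumes "finite X" "0 < t"
  shows "card (inversions_mod t X) = (\<Sum>r<t. card (inversions (runner t r X)))"
  using bij_betw_same_card[OF bij_betw_inversions_mod[OF assms(2), of X]] assms by simp

lemma prod_inversions_mod:
  assumes "finite X" "0 < t"
  shows "(\<Prod>(x, y)\<in>inversions_mod t X. 1 / (real x - real y))
       = (\<Prod>r<t. weight (runner t r X) / real t ^ card (inversions (runner t r X)))"
proof -
  have "(\<Prod>(x, y)\<in>inversions_mod t X. 1 / (real x - real y))
      = (\<Prod>(r, p, q)\<in>(SIGMA r:{..<t}. inversions (runner t r X)). 1 / (real t * (real p - real q)))"
    by (subst prod.reindex_bij_betw[OF bij_betw_inversions_mod[OF assms(2)], symmetric])
      (simp add: case_prod_beta algebra_simps)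
  also have "\<dots> = (\<Prod>r<t. \<Prod>(p, q)\<in>inversions (runner t r X). 1 / (real t * (real p - real q)))"
    using assms by (subst prod.Sigma) auto
  also have "\<dots> = (\<Prod>r<t. weight (runner t r X) / real t ^ card (inversions (runner t r X)))"
    by (simp add: weight_def prod_dividef prod.distrib case_prod_beta)
  finally show ?thesis .
qed

text \<open>The sum over \<open>r\<close> is twice the size of the \<open>t\<close>-core.\<close>

lemma core_size:
  assumes "finite X" "0 < t" "card X = t * m"
  defines "d \<equiv> \<lambda>r. int (card (runner t r X)) - int m"
  shows "2 * int (card (inversions X)) = 2 * int t * int (card (inversions_mod t X))
    + (\<Sum>r<t. d r * (int t * d r + 2 * int r - int t + 1))"
proof -
  define c where "c r = int (card (runner t r X))" for r
  have choose: "2 * int (k choose 2) = int k * (int k - 1)" for k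
  proof (induction k)
    case (Suc k)
    have "Suc k choose 2 = k + (k choose 2)" by (simp add: numeral_2_eq_2)
    with Suc show ?case by (simp add: algebra_simps)
  qed simp
  have sum2: "2 * int (\<Sum>Y) = 2 * int (card (inversions Y)) + int (card Y) * (int (card Y) - 1)"
    if "finite Y" for Y
    unfolding card_inversions[OF that, symmetric] by (simp add: choose)
  have sumc: "(\<Sum>r<t. c r) = int t * int m"
    unfolding c_def of_nat_sum[symmetric] of_nat_mult[symmetric]
    using card_eq_sum_runners[OF assms(1,2)] assms(3) by simp
  have "2 * int (\<Sum>X) = (\<Sum>r<t. int t * (2 * int (\<Sum>(runner t r X))) + 2 * int r * c r)"
    unfolding sum_runners[OF assms(1,2), of "\<lambda>x. x"] of_nat_sum sum_distrib_left
    by (simp add: sum.distrib c_def sum_distrib_left algebra_simps)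
  also have "\<dots> = (\<Sum>r<t. int t * (2 * int (card (inversions (runner t r X))) + c r * (c r - 1)) + 2 * int r * c r)"
    using assms(1,2) by (simp only: sum2 finite_runner c_def)
  \<comment> \<open>Substitute \<open>c r = m + d r\<close>. What is left besides the quadratic term
    in \<open>d r\<close> is linear in \<open>c r\<close>, constant, or a multiple of
    \<open>2 * r - t + 1\<close>, and each of these can be summed over \<open>r\<close>.\<close>
  also have "\<dots> = (\<Sum>r<t. 2 * int t * int (card (inversions (runner t r X))) + d r * (int t * d r + 2 * int r - int t + 1)
      + (2 * int t * int m - 1) * c r - int t * int m * int m + int m * (2 * int r - int t + 1))"
    by (intro sum.cong refl) (simp add: d_def c_def algebra_simps)
  also have "\<dots> = 2 * int t * int (card (inversions_mod t X)) + (\<Sum>r<t. d r * (int t * d r + 2 * int r - int t + 1))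
      + (2 * int t * int m - 1) * (int t * int m) - int t * (int t * int m * int m) + int m * (\<Sum>r<t. 2 * int r - int t + 1)"
    using sumc assms(1,2) by (simp add: sum.distrib sum_subtractf card_inversions_mod flip: sum_distrib_left)
  \<comment> \<open>The residues are symmetric about \<open>(t - 1) / 2\<close>.\<close>
  also have "(\<Sum>r<t. 2 * int r - int t + 1) = 0"
  proof -
    have "(\<Sum>r<k. 2 * int r) = int k * (int k - 1)" for k :: nat
      by (induction k) (auto simp: algebra_simps)
    then show ?thesis by (simp add: sum.distrib sum_subtractf algebra_simps)
  qed
  finally show ?thesis
    unfolding sum2[OF assms(1)] using assms(3) by (simp add: algebra_simps)
qed

text \<open>The two factors have the same sign: for \<open>d \<ge> 1\<close> the second is at least
  \<open>2 * r + 1\<close>, for \<open>d \<le> - 1\<close> it is at most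
  \<open>2 * r - 2 * t + 1 < 0\<close>.\<close>

lemma core_summand:
  fixes t d r :: int
  assumes "0 \<le> r" "r < t"
  shows "0 \<le> d * (t * d + 2 * r - t + 1)" "d * (t * d + 2 * r - t + 1) = 0 \<longleftrightarrow> d = 0"
proof -
  have "0 < d * (t * d + 2 * r - t + 1)" if "d \<noteq> 0"
  proof (cases "0 < d")
    case True
    then have "t * 1 \<le> t * d" using assms by (intro mult_left_mono) auto
    then have "0 < t * d + 2 * r - t + 1" using assms by linarith
    then show ?thesis using True by simp
  next
    case False
    then have "t * d \<le> t * (- 1)" using assms that by (intro mult_left_mono) auto
    then have "t * d + 2 * r - t + 1 < 0" using assms by linarith
    then show ?thesis using False that by (simp add: mult_neg_neg)
  qed
  then show "0 \<le> d * (t * d + 2 * r - t + 1)" "d * (t * d + 2 * r - t + 1) = 0 \<longleftrightarrow> d = 0"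
    by (cases "d = 0"; force)+
qed

text \<open>By \<open>core_size\<close> the equation says that a sum of nonnegative terms vanishes,
  hence that each \<open>d r\<close> is 0.\<close>

lemma empty_core_iff:
  assumes "finite X" "0 < t" "card X = t * m"
  shows "card (inversions X) = t * card (inversions_mod t X) \<longleftrightarrow> (\<forall>r<t. card (runner t r X) = m)"
proof -
  define d where "d = (\<lambda>r. int (card (runner t r X)) - int m)"
  have "card (inversions X) = t * card (inversions_mod t X)
      \<longleftrightarrow> 2 * int (card (inversions X)) = 2 * int t * int (card (inversions_mod t X))"
    by (simp flip: of_nat_mult)
  also have "\<dots> \<longleftrightarrow> (\<Sum>r<t. d r * (int t * d r + 2 * int r - int t + 1)) = 0"
    using core_size[OF assms] by (simp add: d_def)
  also have "\<dots> \<longleftrightarrow> (\<forall>r<t. d r = 0)"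
    using core_summand by (subst sum_nonneg_eq_0_iff) auto
  also have "\<dots> \<longleftrightarrow> (\<forall>r<t. card (runner t r X) = m)"
    by (simp add: d_def)
  finally show ?thesis .
qed

section \<open>Reflection of bead sets and of their runners\<close>

definition reflect :: "nat \<Rightarrow> nat set \<Rightarrow> nat set" where
  "reflect N X = {q. q < N \<and> N - Suc q \<notin> X}"

text \<open>Complementation exchanges beads and gaps, and the reversal restores their order;
  differences are preserved.\<close>

lemma bij_betw_inversions_reflect:
  assumes "X \<subseteq> {..<N}"
  shows "bij_betw (\<lambda>(x, y). (N - Suc y, N - Suc x)) (inversions X) (inversions (reflect N X))"
proof (rule bij_betw_byWitness[where f' = "\<lambda>(x, y). (N - Suc y, N - Suc x)"], goal_cases)
  case 1
  then show ?case using assms by (auto simp: inversions_def subset_iff)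
next
  case 2
  then show ?case by (auto simp: inversions_def reflect_def)
next
  case 3
  then show ?case using assms by (auto simp: inversions_def reflect_def subset_iff)
next
  case 4
  then show ?case using assms by (auto simp: inversions_def reflect_def subset_iff)
qed

lemma card_inversions_reflect:
  assumes "X \<subseteq> {..<N}"
  shows "card (inversions (reflect N X)) = card (inversions X)"
  using bij_betw_same_card[OF bij_betw_inversions_reflect[OF assms]] by simp

lemma weight_reflect:
  assumes "X \<subseteq> {..<N}"
  shows "weight (reflect N X) = weight X"
  unfolding weight_def
  by (subst prod.reindex_bij_betw[OF bij_betw_inversions_reflect[OF assms], symmetric], rule prod.cong)
    (use assms in \<open>auto simp: inversions_def subset_iff of_nat_diff Suc_leI\<close>)

lemma card_reflect:
  assumes "X \<subseteq> {..<N}"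
  shows "card (reflect N X) = N - card X"
proof -
  have "bij_betw (\<lambda>x. N - Suc x) ({..<N} - X) (reflect N X)"
    by (rule bij_betw_byWitness[where f' = "\<lambda>x. N - Suc x"]) (use assms in \<open>auto simp: reflect_def\<close>)
  then have "card (reflect N X) = card ({..<N} - X)"
    by (metis bij_betw_same_card)
  then show ?thesis using assms by (simp add: card_Diff_subset finite_subset)
qed

text \<open>In a window of \<open>t * M\<close> positions, reversal takes \<open>t * q + r\<close>
  to \<open>t * (M - Suc q) + (t - Suc r)\<close>: quotient and residue are both reversed.\<close>

lemma runner_reflect:
  assumes "r < t"
  shows "runner t (t - Suc r) (reflect (t * M) X) = reflect M (runner t r X)"
proof -
  have eq: "t * M - Suc (t * q + (t - Suc r)) = t * (M - Suc q) + r" if "q < M" for q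
  proof -
    have "t * M = t * (M - Suc q) + t * Suc q"
      unfolding distrib_left[symmetric] using that by simp
    then show ?thesis using assms by simp
  qed
  have lt: "t * q + (t - Suc r) < t * M \<longleftrightarrow> q < M" for q
  proof
    assume "q < M"
    then have "t * Suc q \<le> t * M" by (intro mult_le_mono) auto
    then show "t * q + (t - Suc r) < t * M" using assms by (simp; linarith)
  next
    assume "t * q + (t - Suc r) < t * M"
    then have "t * q < t * M" by linarith
    then show "q < M" by simp
  qed
  show ?thesis
    by (auto simp: runner_def reflect_def lt eq)
qed

lemma reflect_reflect:
  assumes "X \<subseteq> {..<N}"
  shows "reflect N (reflect N X) = X"
  using assms by (auto simp: reflect_def)

lemma runner_subset:
  assumes "X \<subseteq> {..<t * M}"
  shows "runner t r X \<subseteq> {..<M}"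
proof
  fix q assume "q \<in> runner t r X"
  then have "t * q + r < t * M" using assms by (auto simp: runner_def)
  then have "t * q < t * M" by linarith
  then show "q \<in> {..<M}" by simp
qed

lemma runners_eqI:
  assumes "0 < t" "\<And>r. r < t \<Longrightarrow> runner t r X = runner t r Y"
  shows "X = Y"
proof (rule set_eqI)
  fix x
  have "x div t \<in> runner t (x mod t) X \<longleftrightarrow> x div t \<in> runner t (x mod t) Y"
    using assms by simp
  then show "x \<in> X \<longleftrightarrow> x \<in> Y" by (simp add: runner_def)
qed

lemma lessThan_double: "{..<2 * s} = {..<s} \<union> (\<lambda>r. 2 * s - Suc r) ` {..<s}" for s :: nat
proof -
  have "x \<in> (\<lambda>r. 2 * s - Suc r) ` {..<s}" if "x < 2 * s" "\<not> x < s" for x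
    using that by (intro image_eqI[of _ _ "2 * s - Suc x"]) auto
  then show ?thesis by auto
qed

text \<open>The pairing of \<open>r\<close> with \<open>2 * s - Suc r\<close> has no fixed point.
  The locale covers both the sums of inversions and the products of weights.\<close>

lemma (in comm_monoid_set) lessThan_double_symmetric:
  fixes s :: nat
  assumes "\<And>r. r < s \<Longrightarrow> h (2 * s - Suc r) = h r"
  shows "F h {..<2 * s} = F h {..<s} \<^bold>* F h {..<s}"
proof -
  have inj: "inj_on (\<lambda>r. 2 * s - Suc r) {..<s}" by (auto simp: inj_on_def)
  have "F h {..<2 * s} = F h {..<s} \<^bold>* F h ((\<lambda>r. 2 * s - Suc r) ` {..<s})"
    unfolding lessThan_double by (rule union_disjoint) auto
  also have "F h ((\<lambda>r. 2 * s - Suc r) ` {..<s}) = F h {..<s}"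
    unfolding reindex[OF inj] by (rule cong) (use assms in auto)
  finally show ?thesis .
qed

section \<open>Beta sets of partitions\<close>

text \<open>Continuation by zeros provides \<open>K\<close> beads even when there are fewer
  parts.\<close>

definition part :: "nat list \<Rightarrow> nat \<Rightarrow> nat" where
  "part xs i = (if i < length xs then xs ! i else 0)"

definition fits :: "nat \<Rightarrow> nat list \<Rightarrow> bool" where
  "fits K xs \<longleftrightarrow> is_partition xs \<and> length xs \<le> K \<and> part xs 0 \<le> K"

text \<open>Rows are counted from 0, hence \<open>K - Suc i\<close>; this shift separates the beads
  of equal parts.\<close>

definition bead :: "nat \<Rightarrow> nat list \<Rightarrow> nat \<Rightarrow> nat" where
  "bead K xs i = part xs i + (K - Suc i)"

definition beta_set :: "nat \<Rightarrow> nat list \<Rightarrow> nat set" where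
  "beta_set K xs = bead K xs ` {..<K}"

lemma mem_ferrers: "(i, j) \<in> ferrers xs \<longleftrightarrow> j < part xs i"
  by (simp add: ferrers_def part_def)

lemma mem_ferrers_conjugate:
  assumes "is_partition xs"
  shows "(i, j) \<in> ferrers xs \<longleftrightarrow> i < part (conjugate xs) j"
  unfolding mem_ferrers[symmetric] ferrers_conjugate[OF assms] by force

lemma part_antimono:
  assumes "is_partition xs" "i \<le> j"
  shows "part xs j \<le> part xs i"
  using is_partition_nth_mono[OF assms] assms(2) by (auto simp: part_def)

lemma partition_eqI:
  assumes "is_partition xs" "is_partition ys" "\<And>i. part xs i = part ys i"
  shows "xs = ys"
proof -
  have pos: "part zs i > 0 \<longleftrightarrow> i < length zs" if "is_partition zs" for zs i
    using that by (auto simp: part_def is_partition_def)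
  have "i < length xs \<longleftrightarrow> i < length ys" for i
    using pos[OF assms(1)] pos[OF assms(2)] assms(3) by metis
  then have "length xs = length ys"
    by (meson linorder_neqE_nat less_irrefl)
  then show ?thesis
    using assms(3) by (intro nth_equalityI) (auto simp: part_def split: if_splits, metis)
qed

lemma fitsI:
  assumes "is_partition xs" "sum_list xs \<le> K"
  shows "fits K xs"
proof -
  have "length xs \<le> sum_list xs" if "\<forall>x\<in>set xs. 0 < x" for xs :: "nat list"
    using that by (induction xs) auto
  moreover have "part xs 0 \<le> sum_list xs"
    by (auto simp: part_def intro!: member_le_sum_list)
  ultimately show ?thesis
    using assms by (force simp: fits_def is_partition_def)
qed

lemma fits_conjugate:
  assumes "fits K xs"
  shows "fits K (conjugate xs)"
proof -
  have xs: "is_partition xs" "length xs \<le> K" "part xs 0 \<le> K"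
    using assms by (auto simp: fits_def)
  have "length (conjugate xs) = part xs 0"
    by (auto simp: conjugate_def part_def hd_conv_nth)
  moreover have "part (conjugate xs) 0 \<le> length xs"
    using mem_ferrers_conjugate[OF xs(1), of "length xs" 0] by (simp add: ferrers_def)
  ultimately show ?thesis
    using xs by (simp add: fits_def is_partition_conjugate)
qed

lemma bead_strict_antimono:
  assumes "is_partition xs" "i < j" "j < K"
  shows "bead K xs j < bead K xs i"
  using part_antimono[OF assms(1), of i j] assms(2,3) by (simp add: bead_def)

lemma bead_inj:
  assumes "is_partition xs" "bead K xs i = bead K xs j" "i < K" "j < K"
  shows "i = j"
  using bead_strict_antimono[OF assms(1)] assms(2-4) by (metis less_irrefl linorder_neqE_nat)

lemma card_beta_set:
  assumes "is_partition xs"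
  shows "card (beta_set K xs) = K"
  unfolding beta_set_def using bead_inj[OF assms] by (subst card_image) (auto simp: inj_on_def)

lemma finite_beta_set [simp]: "finite (beta_set K xs)"
  by (simp add: beta_set_def)

lemma bead_less:
  assumes "fits K xs" "i < K"
  shows "bead K xs i < 2 * K"
  using part_antimono[of xs 0 i] assms by (auto simp: fits_def bead_def)

lemma beta_set_subset:
  assumes "fits K xs"
  shows "beta_set K xs \<subseteq> {..<2 * K}"
  using bead_less[OF assms] by (auto simp: beta_set_def)

text \<open>The rank of a bead in its beta set determines its index.\<close>

lemma card_beads_above:
  assumes "is_partition xs" "i < K"
  shows "card {x \<in> beta_set K xs. bead K xs i < x} = i"
proof -
  have "j < i" if "bead K xs i < bead K xs j" "j < K" for j
    using that bead_strict_antimono[OF assms(1), of i j K] by (metis less_asym' linorder_neqE_nat)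
  then have "{x \<in> beta_set K xs. bead K xs i < x} = bead K xs ` {..<i}"
    using bead_strict_antimono[OF assms(1) _ assms(2)] assms(2) by (auto simp: beta_set_def)
  moreover have "inj_on (bead K xs) {..<i}"
    using bead_inj[OF assms(1)] assms(2) by (auto simp: inj_on_def)
  ultimately show ?thesis by (simp add: card_image)
qed

lemma beta_set_inj:
  assumes "fits K xs" "fits K ys" "beta_set K xs = beta_set K ys"
  shows "xs = ys"
proof (rule partition_eqI)
  show p: "is_partition xs" "is_partition ys" using assms by (auto simp: fits_def)
  fix i
  show "part xs i = part ys i"
  proof (cases "i < K")
    case True
    then have "bead K xs i \<in> beta_set K ys" using assms(3) by (auto simp: beta_set_def)
    then obtain j where j: "j < K" "bead K xs i = bead K ys j" by (auto simp: beta_set_def)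
    then have "i = j"
      using card_beads_above[OF p(1) True] card_beads_above[OF p(2) j(1)] assms(3) by simp
    then show ?thesis using j(2) by (simp add: bead_def)
  next
    case False
    then show ?thesis using assms(1,2) by (simp add: part_def fits_def)
  qed
qed

text \<open>The reflected bead of column \<open>j\<close> is
  \<open>K + j - part (conjugate xs) j\<close>. A box satisfies both \<open>j < part xs i\<close>
  and \<open>i < part (conjugate xs) j\<close>, a non-box neither, so the bead of row
  \<open>i\<close> lies strictly on one side or the other.\<close>

lemma bead_gap:
  assumes "fits K xs" "i < K" "j < K"
  shows "2 * K - Suc (bead K (conjugate xs) j) < bead K xs i \<longleftrightarrow> (i, j) \<in> ferrers xs"
    and "2 * K - Suc (bead K (conjugate xs) j) \<noteq> bead K xs i"
proof -
  have "part (conjugate xs) j \<le> K"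
    using fits_conjugate[OF assms(1)] part_antimono[of "conjugate xs" 0 j] by (auto simp: fits_def)
  moreover have "j < part xs i \<longleftrightarrow> i < part (conjugate xs) j"
    using mem_ferrers_conjugate[of xs i j] assms(1) by (simp add: fits_def mem_ferrers)
  ultimately show "2 * K - Suc (bead K (conjugate xs) j) < bead K xs i \<longleftrightarrow> (i, j) \<in> ferrers xs"
    "2 * K - Suc (bead K (conjugate xs) j) \<noteq> bead K xs i"
    using assms(2,3) unfolding bead_def mem_ferrers by linarith+
qed

text \<open>By \<open>bead_gap\<close> the reflected beads of the conjugate are gaps; this gives one
  inclusion, and both sets have \<open>K\<close> elements.\<close>

lemma beta_set_conjugate:
  assumes "fits K xs"
  shows "beta_set K (conjugate xs) = reflect (2 * K) (beta_set K xs)"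
proof (rule card_subset_eq)
  show "finite (reflect (2 * K) (beta_set K xs))" by (simp add: reflect_def)
  show "beta_set K (conjugate xs) \<subseteq> reflect (2 * K) (beta_set K xs)"
    using bead_less[OF fits_conjugate[OF assms]] bead_gap(2)[OF assms]
    by (auto simp: reflect_def beta_set_def)
  show "card (beta_set K (conjugate xs)) = card (reflect (2 * K) (beta_set K xs))"
    using assms beta_set_subset[OF assms]
    by (simp add: card_reflect card_beta_set fits_def is_partition_conjugate)
qed

section \<open>Boxes as inversions, and hook lengths as differences\<close>

lemma bij_betw_ferrers_inversions:
  assumes "fits K xs"
  shows "bij_betw (\<lambda>(i, j). (bead K xs i, 2 * K - Suc (bead K (conjugate xs) j)))
    (ferrers xs) (inversions (beta_set K xs))"
proof -
  have p: "is_partition xs" "is_partition (conjugate xs)" and fc: "fits K (conjugate xs)"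
    using assms fits_conjugate[OF assms] by (auto simp: fits_def)
  have F: "i < K" "j < K" if "(i, j) \<in> ferrers xs" for i j
  proof -
    have "j < part xs 0" using that part_antimono[OF p(1), of 0 i] by (simp add: mem_ferrers)
    then show "i < K" "j < K" using that assms by (auto simp: fits_def ferrers_def)
  qed
  have inj: "j = j'" if "2 * K - Suc (bead K (conjugate xs) j) = 2 * K - Suc (bead K (conjugate xs) j')" "j < K" "j' < K" for j j'
  proof (rule bead_inj[OF p(2), of K])
    show "bead K (conjugate xs) j = bead K (conjugate xs) j'"
      using that(1) bead_less[OF fc that(2)] bead_less[OF fc that(3)] by linarith
  qed (use that in auto)
  show ?thesis
    unfolding bij_betw_def
  proof (intro conjI equalityI subsetI)
    show "inj_on (\<lambda>(i, j). (bead K xs i, 2 * K - Suc (bead K (conjugate xs) j))) (ferrers xs)"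
    proof (rule inj_onI)
      fix c d
      assume cd: "c \<in> ferrers xs" "d \<in> ferrers xs"
        and eq: "(case c of (i, j) \<Rightarrow> (bead K xs i, 2 * K - Suc (bead K (conjugate xs) j)))
          = (case d of (i, j) \<Rightarrow> (bead K xs i, 2 * K - Suc (bead K (conjugate xs) j)))"
      obtain i j i' j' where c: "c = (i, j)" "d = (i', j')" by (cases c, cases d)
      note e = eq[unfolded c prod.case prod.inject]
      have "i = i'"
        by (rule bead_inj[OF p(1) conjunct1[OF e]]) (use cd F in \<open>auto simp: c\<close>)
      moreover have "j = j'"
        by (rule inj[OF conjunct2[OF e]]) (use cd F in \<open>auto simp: c\<close>)
      ultimately show "c = d" by (simp add: c)
    qed
  next
    fix b assume "b \<in> (\<lambda>(i, j). (bead K xs i, 2 * K - Suc (bead K (conjugate xs) j))) ` ferrers xs"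
    then obtain i j where b: "b = (bead K xs i, 2 * K - Suc (bead K (conjugate xs) j))" "(i, j) \<in> ferrers xs"
      by auto
    then show "b \<in> inversions (beta_set K xs)"
      using bead_gap[OF assms _ F(2)] F by (auto simp: inversions_def beta_set_def)
  next
    fix b assume "b \<in> inversions (beta_set K xs)"
    then obtain x y where b: "b = (x, y)" "x \<in> beta_set K xs" "y \<notin> beta_set K xs" "y < x"
      by (auto simp: inversions_def)
    then have y: "y < 2 * K" using beta_set_subset[OF assms] by auto
    \<comment> \<open>Every gap below \<open>2 * K\<close> belongs to a column, since the reflection
      is the beta set of the conjugate.\<close>
    then have "2 * K - Suc y \<in> beta_set K (conjugate xs)"
      using b(3) by (auto simp: beta_set_conjugate[OF assms] reflect_def)
    then obtain i j where ij: "i < K" "x = bead K xs i" "j < K" "2 * K - Suc y = bead K (conjugate xs) j"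
      using b(2) by (auto simp: beta_set_def)
    then have y': "y = 2 * K - Suc (bead K (conjugate xs) j)" using y by auto
    then have "(i, j) \<in> ferrers xs" using bead_gap(1)[OF assms ij(1,3)] b(4) ij(2) by simp
    then show "b \<in> (\<lambda>(i, j). (bead K xs i, 2 * K - Suc (bead K (conjugate xs) j))) ` ferrers xs"
      using b(1) ij(2) y' by (intro image_eqI[of _ _ "(i, j)"]) auto
  qed
qed

lemma card_inversions_beta_set:
  assumes "fits K xs"
  shows "card (inversions (beta_set K xs)) = sum_list xs"
  using bij_betw_same_card[OF bij_betw_ferrers_inversions[OF assms]] by (simp add: card_ferrers)

text \<open>The hook splits into its row segment, including the corner, and the column segment
  strictly below.\<close>

lemma hook_length_eq:
  assumes "is_partition xs" "(i, j) \<in> ferrers xs"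
  shows "hook_length xs (i, j) = (part xs i - j) + (part (conjugate xs) j - Suc i)"
proof -
  have "{c \<in> ferrers xs. (fst c = i \<and> j \<le> snd c) \<or> (snd c = j \<and> i \<le> fst c)}
      = Pair i ` {j..<part xs i} \<union> (\<lambda>k. (k, j)) ` {Suc i..<part (conjugate xs) j}" (is "?L = ?R")
  proof (intro set_eqI)
    fix c :: "nat \<times> nat"
    obtain a b where c: "c = (a, b)" by (cases c)
    show "c \<in> ?L \<longleftrightarrow> c \<in> ?R"
      using assms(2) mem_ferrers_conjugate[OF assms(1), of a j]
      by (auto simp: c mem_ferrers image_iff le_less Suc_le_eq)
  qed
  moreover have "card (Pair i ` {j..<part xs i}) = part xs i - j"
    by (subst card_image) (auto simp: inj_on_def)
  moreover have "card ((\<lambda>k. (k, j)) ` {Suc i..<part (conjugate xs) j}) = part (conjugate xs) j - Suc i"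
    by (subst card_image) (auto simp: inj_on_def)
  moreover have "Pair i ` {j..<part xs i} \<inter> (\<lambda>k. (k, j)) ` {Suc i..<part (conjugate xs) j} = {}"
    by auto
  ultimately show ?thesis
    by (simp add: hook_length_def card_Un_disjoint)
qed

lemma hook_length_bead:
  assumes "fits K xs" "(i, j) \<in> ferrers xs"
  shows "hook_length xs (i, j) = bead K xs i - (2 * K - Suc (bead K (conjugate xs) j))"
proof -
  have p: "is_partition xs" using assms by (simp add: fits_def)
  have "j < part xs i" "i < part (conjugate xs) j"
    using assms(2) mem_ferrers_conjugate[OF p] by (auto simp: mem_ferrers)
  moreover have "part xs i \<le> K" "part (conjugate xs) j \<le> K"
    using assms(1) fits_conjugate[OF assms(1)] part_antimono[of xs 0 i] part_antimono[of "conjugate xs" 0 j]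
    by (auto simp: fits_def)
  ultimately show ?thesis
    unfolding hook_length_eq[OF p assms(2)] bead_def by linarith
qed

lemma hooks_beta_set:
  assumes "fits K xs"
  shows "hooks t xs = image_mset (\<lambda>(x, y). x - y) (mset_set (inversions_mod t (beta_set K xs)))"
proof -
  let ?b = "\<lambda>(i, j). (bead K xs i, 2 * K - Suc (bead K (conjugate xs) j))"
  have "image_mset (hook_length xs) (mset_set (ferrers xs)) = image_mset ((\<lambda>(x, y). x - y) \<circ> ?b) (mset_set (ferrers xs))"
    by (intro image_mset_cong) (auto simp: hook_length_bead[OF assms])
  also have "\<dots> = image_mset (\<lambda>(x, y). x - y) (mset_set (?b ` ferrers xs))"
    using bij_betw_ferrers_inversions[OF assms]
    by (subst image_mset_mset_set[symmetric]) (auto simp: bij_betw_def multiset.map_comp)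
  also have "?b ` ferrers xs = inversions (beta_set K xs)"
    using bij_betw_ferrers_inversions[OF assms] by (simp add: bij_betw_def)
  finally show ?thesis
    by (simp add: hooks_def filter_mset_image_mset inversions_mod_def case_prod_unfold)
qed

lemma beta_set_surj:
  assumes "X \<subseteq> {..<2 * K}" "card X = K"
  obtains xs where "fits K xs" "beta_set K xs = X"
proof -
  have fin: "finite X" using assms(1) finite_subset by blast
  define l where "l = sorted_list_of_set X"
  have l: "length l = K" "set l = X" and sorted: "sorted_wrt (<) l"
    using fin assms(2) by (simp_all add: l_def)
  \<comment> \<open>A strictly increasing list of naturals grows by at least 1 per index; this makes
    the differences \<open>a\<close> nonincreasing.\<close>
  have step: "l ! k + (k' - k) \<le> l ! k'" if "k \<le> k'" "k' < K" for k k'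
    using that
  proof (induction k' rule: dec_induct)
    case (step k')
    then have "l ! k' < l ! Suc k'"
      using sorted l(1) by (simp add: sorted_wrt_iff_nth_less)
    with step show ?case by simp
  qed simp
  have ge: "k \<le> l ! k" if "k < K" for k using step[of 0 k] that by simp
  \<comment> \<open>The list is read from its largest entry, and the staircase of positions is
    subtracted.\<close>
  define a where "a i = l ! (K - Suc i) - (K - Suc i)" for i
  have a_mono: "a j \<le> a i" if "i \<le> j" "j < K" for i j
    using step[of "K - Suc j" "K - Suc i"] that unfolding a_def by linarith
  \<comment> \<open>As \<open>a\<close> is nonincreasing, this cuts off exactly its zeros.\<close>
  define xs where "xs = takeWhile (\<lambda>x. 0 < x) (map a [0..<K])"
  have len: "length xs \<le> K"
    using length_takeWhile_le[of _ "map a [0..<K]"] by (simp add: xs_def)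
  have nth: "xs ! i = a i" if "i < length xs" for i
    using that len by (simp add: xs_def takeWhile_nth)
  have part: "part xs i = a i" if "i < K" for i
  proof (cases "i < length xs")
    case False
    then have "length xs < K" using that by simp
    then have "a (length xs) = 0"
      using nth_length_takeWhile[of "\<lambda>x. 0 < x" "map a [0..<K]"] by (simp add: xs_def)
    then show ?thesis using a_mono[of "length xs" i] False that by (simp add: part_def)
  qed (simp add: part_def nth)
  have "is_partition xs"
    unfolding is_partition_def sorted_wrt_iff_nth_less
    using a_mono len by (auto simp: nth) (auto simp: xs_def dest!: set_takeWhileD)
  moreover have "part xs 0 \<le> K"
  proof (cases "K = 0")
    case False
    then have "l ! (K - 1) \<in> X" using l by (metis diff_less gr0I nth_mem zero_less_one)
    then show ?thesis using False assms(1) part[of 0] by (auto simp: a_def)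
  qed (use len in \<open>simp add: part_def\<close>)
  ultimately have "fits K xs" using len by (simp add: fits_def)
  moreover have "beta_set K xs = X"
  proof -
    have "bead K xs i = l ! (K - Suc i)" if "i < K" for i
      using that ge[of "K - Suc i"] by (simp add: bead_def part a_def)
    then have "beta_set K xs = (\<lambda>i. l ! (K - Suc i)) ` {..<K}"
      by (auto simp: beta_set_def)
    also have "\<dots> = (!) l ` ((\<lambda>i. K - Suc i) ` {..<K})"
      by (simp add: image_image)
    also have "(\<lambda>i. K - Suc i) ` {..<K} = {..<K}"
    proof (intro equalityI subsetI)
      fix i assume "i \<in> {..<K}"
      then show "i \<in> (\<lambda>i. K - Suc i) ` {..<K}" by (intro image_eqI[of _ _ "K - Suc i"]) auto
    qed auto
    also have "(!) l ` {..<K} = X"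
      using l by (auto simp: set_conv_nth)
    finally show ?thesis .
  qed
  ultimately show ?thesis using that by blast
qed

section \<open>Symmetric beta sets\<close>

text \<open>The window length is a multiple of \<open>2 * t\<close>, so that reflection permutes the
  runners; the symmetry forces \<open>t * m\<close> beads.\<close>

definition symmetric_beads :: "nat \<Rightarrow> nat \<Rightarrow> nat \<Rightarrow> nat set set" where
  "symmetric_beads t m n = {X. X \<subseteq> {..<2 * (t * m)} \<and> reflect (2 * (t * m)) X = X
     \<and> card (inversions X) = 2 * t * n \<and> card (inversions_mod t X) = 2 * n}"

text \<open>The bound \<open>2 * n \<le> m\<close> gives \<open>2 * t * n \<le> t * m\<close>, so
  every partition of this size fits into the square.\<close>

lemma bij_betw_beta_set:
  assumes "2 * n \<le> m"
  shows "bij_betw (beta_set (t * m))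
    {xs. is_partition xs \<and> self_conjugate xs \<and> sum_list xs = 2 * t * n \<and> size (hooks t xs) = 2 * n}
    (symmetric_beads t m n)"
proof -
  let ?K = "t * m"
  let ?S = "{xs. is_partition xs \<and> self_conjugate xs \<and> sum_list xs = 2 * t * n \<and> size (hooks t xs) = 2 * n}"
  have "2 * t * n \<le> t * m" using mult_le_mono2[OF assms, of t] by (simp add: mult_ac)
  then have fits: "fits ?K xs" if "xs \<in> ?S" for xs
    using that by (intro fitsI) auto
  have size: "size (hooks t xs) = card (inversions_mod t (beta_set ?K xs))" if "fits ?K xs" for xs
    by (simp add: hooks_beta_set[OF that])
  show ?thesis
    unfolding bij_betw_def
  proof (intro conjI equalityI subsetI)
    show "inj_on (beta_set ?K) ?S"
      using fits beta_set_inj by (meson inj_onI)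
  next
    fix X assume "X \<in> beta_set ?K ` ?S"
    then obtain xs where xs: "xs \<in> ?S" "X = beta_set ?K xs" by auto
    then show "X \<in> symmetric_beads t m n"
      using fits[OF xs(1)] beta_set_subset[OF fits[OF xs(1)]] beta_set_conjugate[OF fits[OF xs(1)]]
      by (simp add: symmetric_beads_def self_conjugate_def card_inversions_beta_set size)
  next
    fix X assume "X \<in> symmetric_beads t m n"
    then have X: "X \<subseteq> {..<2 * ?K}" "reflect (2 * ?K) X = X"
      "card (inversions X) = 2 * t * n" "card (inversions_mod t X) = 2 * n"
      by (auto simp: symmetric_beads_def)
    have "card X \<le> 2 * ?K" using card_mono[OF _ X(1)] by simp
    \<comment> \<open>A set equal to its reflection has as many beads as gaps among the
      \<open>2 * ?K\<close> positions.\<close>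
    then have "card X = ?K" using card_reflect[OF X(1)] X(2) by simp
    then obtain xs where xs: "fits ?K xs" "beta_set ?K xs = X"
      using beta_set_surj[OF X(1)] by blast
    have "conjugate xs = xs"
      using beta_set_conjugate[OF xs(1)] xs(2) X(2)
      by (intro beta_set_inj[OF fits_conjugate[OF xs(1)] xs(1)]) simp
    moreover have "sum_list xs = 2 * t * n"
      using card_inversions_beta_set[OF xs(1)] xs(2) X(3) by simp
    ultimately have "xs \<in> ?S"
      using xs X(4) by (simp add: size self_conjugate_def fits_def)
    then show "X \<in> beta_set ?K ` ?S" using xs(2) by blast
  qed
qed

lemma runner_symmetric:
  assumes "reflect (2 * (t * m)) X = X" "r < t"
  shows "runner t (t - Suc r) X = reflect (2 * m) (runner t r X)"
  using runner_reflect[OF assms(2), of "2 * m" X] assms(1) by (simp add: mult.left_commute)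

text \<open>The symmetric bead set whose runners \<open>0, \<dots>, s - 1\<close> are given by \<open>f\<close>.\<close>

definition glue :: "nat \<Rightarrow> nat \<Rightarrow> (nat \<Rightarrow> nat set) \<Rightarrow> nat set" where
  "glue s M f = {x. x div (2 * s) \<in> (if x mod (2 * s) < s then f (x mod (2 * s))
     else reflect M (f (2 * s - Suc (x mod (2 * s)))))}"

lemma runner_glue:
  assumes "r < 2 * s"
  shows "runner (2 * s) r (glue s M f) = (if r < s then f r else reflect M (f (2 * s - Suc r)))"
  using assms by (simp add: runner_def glue_def)

lemma glue_properties:
  assumes "0 < s" "\<And>r. r < s \<Longrightarrow> f r \<subseteq> {..<M}"
  shows "glue s M f \<subseteq> {..<2 * s * M}" "reflect (2 * s * M) (glue s M f) = glue s M f"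
proof -
  show "glue s M f \<subseteq> {..<2 * s * M}"
  proof
    fix x assume x: "x \<in> glue s M f"
    have "x mod (2 * s) < 2 * s" using assms(1) by simp
    with x have "x div (2 * s) < M"
      using assms(2)[of "x mod (2 * s)"]
      by (auto simp: glue_def reflect_def split: if_splits)
    then show "x \<in> {..<2 * s * M}"
      using assms(1) by (simp add: div_less_iff_less_mult mult.commute)
  qed
  show "reflect (2 * s * M) (glue s M f) = glue s M f"
  proof (rule runners_eqI)
    fix r assume r: "r < 2 * s"
    define r' where "r' = 2 * s - Suc r"
    \<comment> \<open>Exactly one of the partners \<open>r\<close> and \<open>r'\<close> is below
      \<open>s\<close>: one runner is prescribed by \<open>f\<close>, the other is its
      reflection.\<close>
    have r': "r' < 2 * s" "2 * s - Suc r' = r" "r' < s \<longleftrightarrow> \<not> r < s" using r by (auto simp: r'_def)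
    have "runner (2 * s) r (reflect (2 * s * M) (glue s M f)) = reflect M (runner (2 * s) r' (glue s M f))"
      using runner_reflect[OF r'(1), of M "glue s M f"] by (simp only: r'(2))
    also have "\<dots> = runner (2 * s) r (glue s M f)"
      using r r' assms(2)[of r] by (simp add: runner_glue reflect_reflect flip: r'_def)
    finally show "runner (2 * s) r (reflect (2 * s * M) (glue s M f)) = runner (2 * s) r (glue s M f)" .
  qed (use assms in simp)
qed

lemma card_inversions_mod_symmetric:
  assumes "0 < s" "X \<subseteq> {..<2 * (2 * s * m)}" "reflect (2 * (2 * s * m)) X = X"
  shows "card (inversions_mod (2 * s) X) = 2 * (\<Sum>r<s. card (inversions (runner (2 * s) r X)))"
proof -
  have sub: "runner (2 * s) r X \<subseteq> {..<2 * m}" for r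
    using assms(2) by (intro runner_subset) (simp add: mult_ac)
  have "card (inversions_mod (2 * s) X) = (\<Sum>r<2 * s. card (inversions (runner (2 * s) r X)))"
    using assms(1,2) by (intro card_inversions_mod) (auto simp: finite_subset)
  also have "\<dots> = 2 * (\<Sum>r<s. card (inversions (runner (2 * s) r X)))"
    using runner_symmetric[OF assms(3)] sub
    by (subst sum.lessThan_double_symmetric) (simp_all add: card_inversions_reflect)
  finally show ?thesis .
qed

text \<open>Opposite runners are reflections of each other and have equal weights, which makes the
  product a square.\<close>

lemma prod_inversions_mod_symmetric:
  assumes "0 < s" "X \<subseteq> {..<2 * (2 * s * m)}" "reflect (2 * (2 * s * m)) X = X"
  shows "(\<Prod>(x, y)\<in>inversions_mod (2 * s) X. 1 / (real x - real y))
    = (\<Prod>r<s. (weight (runner (2 * s) r X))\<^sup>2) / real (2 * s) ^ card (inversions_mod (2 * s) X)"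
proof -
  define h where "h r = weight (runner (2 * s) r X) / real (2 * s) ^ card (inversions (runner (2 * s) r X))" for r
  have sub: "runner (2 * s) r X \<subseteq> {..<2 * m}" for r
    using assms(2) by (intro runner_subset) (simp add: mult_ac)
  have "(\<Prod>(x, y)\<in>inversions_mod (2 * s) X. 1 / (real x - real y)) = (\<Prod>r<2 * s. h r)"
    unfolding h_def using assms(1,2) by (intro prod_inversions_mod) (auto simp: finite_subset)
  also have "\<dots> = (\<Prod>r<s. h r) * (\<Prod>r<s. h r)"
    using runner_symmetric[OF assms(3)] sub
    by (intro prod.lessThan_double_symmetric) (simp add: h_def card_inversions_reflect weight_reflect)
  also have "\<dots> = (\<Prod>r<s. (weight (runner (2 * s) r X))\<^sup>2) / real (2 * s) ^ card (inversions_mod (2 * s) X)"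
  proof -
    have "(\<Prod>r<s. h r) = (\<Prod>r<s. weight (runner (2 * s) r X))
        / real (2 * s) ^ (\<Sum>r<s. card (inversions (runner (2 * s) r X)))"
      unfolding h_def by (simp only: prod_dividef power_sum)
    then show ?thesis
      unfolding card_inversions_mod_symmetric[OF assms] prod_power_distrib
      by (simp only: power2_eq_square times_divide_times_eq mult_2 power_add prod.distrib)
  qed
  finally show ?thesis .
qed

text \<open>Symmetry recovers the upper \<open>s\<close> runners from the lower ones, with
  \<open>glue\<close> as the inverse; the two prescribed counts express the empty core, that is,
  \<open>m\<close> beads on each runner.\<close>

lemma bij_betw_runners:
  fixes s m n :: nat
  assumes "0 < s"
  defines "A \<equiv> {Y. Y \<subseteq> {..<2 * m} \<and> card Y = m}"
  shows "bij_betw (\<lambda>X. restrict (\<lambda>r. runner (2 * s) r X) {..<s}) (symmetric_beads (2 * s) m n)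
    {f \<in> PiE {..<s} (\<lambda>_. A). (\<Sum>r<s. card (inversions (f r))) = n}"
proof (rule bij_betw_byWitness[where f' = "glue s (2 * m)"], goal_cases)
  case 1
  show ?case
  proof
    fix X assume "X \<in> symmetric_beads (2 * s) m n"
    then have X: "reflect (2 * (2 * s * m)) X = X"  "X \<subseteq> {..<2 * s * (2 * m)}"
      by (auto simp: symmetric_beads_def mult_ac)
    show "glue s (2 * m) (restrict (\<lambda>r. runner (2 * s) r X) {..<s}) = X"
    proof (rule runners_eqI)
      fix r assume r: "r < 2 * s"
      then show "runner (2 * s) r (glue s (2 * m) (restrict (\<lambda>r. runner (2 * s) r X) {..<s})) = runner (2 * s) r X"
        using runner_symmetric[OF X(1) r] by (auto simp: runner_glue reflect_reflect runner_subset[OF X(2)])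
    qed (use assms in simp)
  qed
next
  case 2
  show ?case
    by (auto simp: fun_eq_iff runner_glue PiE_def extensional_def)
next
  case 3
  show ?case
  proof (clarsimp simp: PiE_iff, intro conjI ballI, goal_cases)
    case (1 X r)
    then have X: "reflect (2 * (2 * s * m)) X = X"  "X \<subseteq> {..<2 * s * (2 * m)}"
      "card (inversions X) = 2 * s * card (inversions_mod (2 * s) X)"
      by (auto simp: symmetric_beads_def mult_ac)
    have "card X = 2 * s * m"
    proof -
      have *: "X \<subseteq> {..<2 * (2 * s * m)}" using X(2) by (simp add: mult_ac)
      have "card X \<le> 2 * (2 * s * m)" using card_mono[OF _ *] by simp
      then show ?thesis using card_reflect[OF *] X(1) by simp
    qed
    then have "card (runner (2 * s) r X) = m"
      using empty_core_iff[of X "2 * s" m] X 1 assms finite_subset[OF X(2)] by auto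
    then show ?case using runner_subset[OF X(2)] by (simp add: A_def)
  next
    case (2 X)
    then show ?case
      using card_inversions_mod_symmetric[OF assms(1), of X m] by (simp add: symmetric_beads_def mult_ac)
  qed
next
  case 4
  show ?case
  proof (rule image_subsetI)
    fix f assume f: "f \<in> {f \<in> PiE {..<s} (\<lambda>_. A). (\<Sum>r<s. card (inversions (f r))) = n}"
    define X where "X = glue s (2 * m) f"
    have sub: "f r \<subseteq> {..<2 * m}" and c: "card (f r) = m" if "r < s" for r
      using f that by (auto simp: A_def PiE_iff)
    have X: "X \<subseteq> {..<2 * (2 * s * m)}" "reflect (2 * (2 * s * m)) X = X"
      using glue_properties[OF assms(1), of f "2 * m", OF sub] by (simp_all add: X_def mult_ac)
    have "card X \<le> 2 * (2 * s * m)" using card_mono[OF _ X(1)] by simp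
    then have cX: "card X = 2 * s * m" using card_reflect[OF X(1)] X(2) by simp
    \<comment> \<open>Reflection in \<open>2 * m\<close> positions keeps the number \<open>m\<close>
      of beads.\<close>
    have "card (runner (2 * s) r X) = m" if "r < 2 * s" for r
      using that sub[of "2 * s - Suc r"] c[of "2 * s - Suc r"] c[of r] by (simp add: X_def runner_glue card_reflect)
    then have "card (inversions X) = 2 * s * card (inversions_mod (2 * s) X)"
      using empty_core_iff[of X "2 * s" m] cX assms finite_subset[OF X(1)] by auto
    moreover have "card (inversions_mod (2 * s) X) = 2 * n"
      unfolding card_inversions_mod_symmetric[OF assms(1) X] using f by (simp add: X_def runner_glue)
    ultimately show "glue s (2 * m) f \<in> symmetric_beads (2 * s) m n"
      using X by (simp add: symmetric_beads_def flip: X_def)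
  qed
qed

section \<open>Evaluation of the sum over self-conjugate partitions\<close>

theorem theorem1p4:
  fixes n t :: nat
  assumes "0 < n" and "0 < t" and "even t"
  shows "(\<Sum>xs | is_partition xs \<and> self_conjugate xs \<and> sum_list xs = 2 * t * n
              \<and> size (hooks t xs) = 2 * n.
            (\<Prod>h\<in>#hooks t xs. 1 / real h))
         = 1 / (fact n * 2 ^ n * real t ^ n)"
proof -
  \<comment> \<open>With this choice \<open>t * m\<close> is the size \<open>2 * t * n\<close> of
    the partitions, so all of them fit.\<close>
  define m where "m = 2 * n"
  obtain s where t: "t = 2 * s" using assms(3) by (elim evenE)
  have s: "0 < s" using assms(2) t by simp
  define A where "A = {Y. Y \<subseteq> {..<2 * m} \<and> card Y = m}"
  define P where "P X = (\<Prod>(x, y)\<in>inversions_mod t X. 1 / (real x - real y))" for X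
  have hooks: "(\<Prod>h\<in>#hooks t xs. 1 / real h) = P (beta_set (t * m) xs)"
    if "is_partition xs" "sum_list xs = 2 * t * n" for xs
  proof -
    have "fits (t * m) xs" using that by (intro fitsI) (simp_all add: m_def)
    then have "(\<Prod>h\<in>#hooks t xs. 1 / real h) = (\<Prod>(x, y)\<in>inversions_mod t (beta_set (t * m) xs). 1 / real (x - y))"
      by (simp add: hooks_beta_set prod_unfold_prod_mset multiset.map_comp comp_def case_prod_unfold)
    also have "\<dots> = P (beta_set (t * m) xs)"
      unfolding P_def by (intro prod.cong) (auto simp: inversions_mod_def inversions_def of_nat_diff)
    finally show ?thesis .
  qed
  have A: "(\<Sum>X | X \<in> A \<and> card (inversions X) = j. (weight X)\<^sup>2) = 1 / fact j" if "j \<le> n" for j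
  proof -
    have "{X. X \<in> A \<and> card (inversions X) = j} = bead_sets m j"
    proof (intro equalityI subsetI)
      fix X assume X: "X \<in> bead_sets m j"
      \<comment> \<open>Positions are below \<open>m + j\<close>, and
        \<open>j \<le> n \<le> m\<close>.\<close>
      have "X \<subseteq> {..<2 * m}"
        using bead_sets_subset[OF X] that unfolding m_def by (fastforce dest: subsetD)
      then show "X \<in> {X. X \<in> A \<and> card (inversions X) = j}"
        using X by (simp add: A_def bead_sets_def)
    qed (auto simp: A_def bead_sets_def intro: finite_subset)
    then show ?thesis using sum_weight_square[of j m] that by (simp add: m_def)
  qed
  have "(\<Sum>xs | is_partition xs \<and> self_conjugate xs \<and> sum_list xs = 2 * t * n \<and> size (hooks t xs) = 2 * n.
      (\<Prod>h\<in>#hooks t xs. 1 / real h))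
    = (\<Sum>xs | is_partition xs \<and> self_conjugate xs \<and> sum_list xs = 2 * t * n \<and> size (hooks t xs) = 2 * n.
      P (beta_set (t * m) xs))"
    by (intro sum.cong) (auto simp: hooks)
  also have "\<dots> = (\<Sum>X\<in>symmetric_beads t m n. P X)"
    by (rule sum.reindex_bij_betw[OF bij_betw_beta_set]) (simp add: m_def)
  \<comment> \<open>Each of the \<open>2 * n\<close> hooks gives a factor \<open>1 / t\<close>. The
    \<open>restrict\<close> presents the summand as a function of the tuple of runners, ready for
    reindexing.\<close>
  also have "\<dots> = (\<Sum>X\<in>symmetric_beads t m n.
      (\<Prod>r<s. (weight (restrict (\<lambda>r. runner (2 * s) r X) {..<s} r))\<^sup>2) / real t ^ (2 * n))"
    using prod_inversions_mod_symmetric[OF s]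
    by (intro sum.cong) (auto simp: P_def symmetric_beads_def t)
  also have "\<dots> = (\<Sum>f | f \<in> PiE {..<s} (\<lambda>_. A) \<and> (\<Sum>r<s. card (inversions (f r))) = n.
      (\<Prod>r<s. (weight (f r))\<^sup>2) / real t ^ (2 * n))"
    unfolding t A_def by (rule sum.reindex_bij_betw[OF bij_betw_runners[OF s]])
  also have "\<dots> = (real s ^ n / fact n) / real t ^ (2 * n)"
    unfolding sum_divide_distrib[symmetric] using A
    by (subst sum_PiE_exponential) (auto simp: A_def)
  \<comment> \<open>Here \<open>s / t = 1 / 2\<close> accounts for the factor
    \<open>2 ^ n\<close>.\<close>
  also have "\<dots> = 1 / (fact n * 2 ^ n * real t ^ n)"
    using s by (simp add: t power_mult_distrib power_mult power2_eq_square field_simps)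
  finally show ?thesis .
qed

end
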